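(* Let $q\in(0,1)$ and $\nu>-1$. Then the radius of starlikeness $r^*\left(g_{\nu}^{(2)}(\cdot;q)\right)$ of the function $$z\mapsto g_{\nu}^{(2)}(z;q)=2^{\nu}c_{\nu}(q)z^{1-\nu}J_{\nu}^{(2)}(z;q)$$ is the smallest positive root of the equation $r\cdot \frac{d}{dr}J_{\nu}^{(2)}(r;q)-(\nu-1)J_{\nu}^{(2)}(r;q)=0$ and satisfies $$2\sqrt{\frac{(q^{\nu+1}-1)(q-1)}{3q^{\nu+1}}}<r^*\left(g_{\nu}^{(2)}(\cdot;q)\right)< 2\sqrt{\frac{3(q^{\nu+1}-1)(q^{\nu+2}-1)(1-q^2)}{q^{\nu+1}(9q-9q^{\nu+2}+q^{\nu+3}-10q^2+9)}}$$ and $$2\sqrt[4]{\frac{(q^{\nu+1}-1)^2(1-q^{\nu+2})(q-1)^2(q+1)}{q^{2\nu+2}(9q-9q^{\nu+2}+q^{\nu+3}-10q^2+9)}}< r^*\left(g_{\nu}^{(2)}(\cdot;q)\right)<\frac{2}{3}\sqrt{\frac{3(1-q^{\nu+1})(q^{\nu+3}-1)(q-1)}{(q+1)q^{\nu+1}}\,q_1^*(\nu)},$$ where $$q_1^*(\nu)=\frac{(q^3+2q^2+2q+1)(9q-9q^{\nu+2}+q^{\nu+3}-10q^2+9)}{a_{\nu}(q)+b_{\nu}(q)},$$ $$a_{\nu}(q)=-9q^{\nu+2}-12q^{\nu+3}-21q^{\nu+4}+3q^{\nu+5}+6q^{\nu+6}+q^{\nu+7}+9q^{2\nu+5}+3q^{2\nu+6},$$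 $$b_{\nu}(q)=3q^{2\nu+7}+q^{2\nu+8}+18q+3q^2-6q^3-15q^4+7q^6+9.$$
   Context: For $a\in\mathbb{C}$ and $q\in(0,1)$: $(a;q)_0=1$, $(a;q)_n=\prod_{k=1}^{n}(1-aq^{k-1})$, $(a;q)_\infty=\prod_{k\geq1}(1-aq^{k-1})$. The Jackson $q$-Bessel function is, for $\nu>-1$, $$J_{\nu}^{(2)}(z;q)=\frac{(q^{\nu+1};q)_{\infty}}{(q;q)_{\infty}}\sum_{n\geq0}\frac{(-1)^{n}\left(\frac{z}{2}\right)^{2n+\nu}}{(q;q)_{n}(q^{\nu+1};q)_{n}}q^{n(n+\nu)},$$ and $c_{\nu}(q)=(q;q)_{\infty}/(q^{\nu+1};q)_{\infty}$; thus $g_\nu^{(2)}(\cdot;q)$ is entire with $g(0)=0$, $g'(0)=1$. For such $f$, the radius of starlikeness is $r^*(f)=\sup\{r>0:\ \mathrm{Re}\,(zf'(z)/f(z))>0 \text{ for all } |z|<r\}$. *)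

theory Defs
  imports "HOL-Analysis.Analysis"
begin

definition qpoch :: "real \<Rightarrow> real \<Rightarrow> nat \<Rightarrow> real" where
  "qpoch a q n = (\<Prod>k<n. 1 - a * q ^ k)"

definition qpoch_inf :: "real \<Rightarrow> real \<Rightarrow> real" where
  "qpoch_inf a q = (\<Prod>k. 1 - a * q ^ k)"

definition jackson_J2 :: "real \<Rightarrow> real \<Rightarrow> complex \<Rightarrow> complex" where
  "jackson_J2 \<nu> q z =
     complex_of_real (qpoch_inf (q powr (\<nu> + 1)) q / qpoch_inf q q) *
     (\<Sum>n. complex_of_real ((-1) ^ n * q powr (real n * (real n + \<nu>))
              / (qpoch q q n * qpoch (q powr (\<nu> + 1)) q n))
           * (z / 2) powr (complex_of_real (2 * real n + \<nu>)))"

definition jackson_J2_real :: "real \<Rightarrow> real \<Rightarrow> real \<Rightarrow> real" where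
  "jackson_J2_real \<nu> q r =
     qpoch_inf (q powr (\<nu> + 1)) q / qpoch_inf q q *
     (\<Sum>n. (-1) ^ n * (r / 2) powr (2 * real n + \<nu>) * q powr (real n * (real n + \<nu>))
              / (qpoch q q n * qpoch (q powr (\<nu> + 1)) q n))"

definition c_nu :: "real \<Rightarrow> real \<Rightarrow> real" where
  "c_nu \<nu> q = qpoch_inf q q / qpoch_inf (q powr (\<nu> + 1)) q"

text \<open>g^(2)_nu(z;q) = 2^nu c_nu(q) z^(1-nu) J^(2)_nu(z;q) (principal branches; value 0 at z = 0).\<close>
definition g_nu2 :: "real \<Rightarrow> real \<Rightarrow> complex \<Rightarrow> complex" where
  "g_nu2 \<nu> q z = complex_of_real (2 powr \<nu> * c_nu \<nu> q) * z powr (complex_of_real (1 - \<nu>))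
                   * jackson_J2 \<nu> q z"

text \<open>Radius of starlikeness. At z = 0 the quotient z f'(z)/f(z) is understood as its limit 1,
  so only z \<noteq> 0 is tested.\<close>
definition radius_starlike :: "(complex \<Rightarrow> complex) \<Rightarrow> real" where
  "radius_starlike f = Sup {r. r > 0 \<and>
      (\<forall>z. z \<noteq> 0 \<and> norm z < r \<longrightarrow> Re (z * deriv f z / f z) > 0)}"

definition a_nu :: "real \<Rightarrow> real \<Rightarrow> real" where
  "a_nu \<nu> q = - 9 * q powr (\<nu>+2) - 12 * q powr (\<nu>+3) - 21 * q powr (\<nu>+4) + 3 * q powr (\<nu>+5)
     + 6 * q powr (\<nu>+6) + q powr (\<nu>+7) + 9 * q powr (2*\<nu>+5) + 3 * q powr (2*\<nu>+6)"

definition b_nu :: "real \<Rightarrow> real \<Rightarrow> real" where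
  "b_nu \<nu> q = 3 * q powr (2*\<nu>+7) + q powr (2*\<nu>+8) + 18*q + 3*q^2 - 6*q^3 - 15*q^4 + 7*q^6 + 9"

definition D_nu :: "real \<Rightarrow> real \<Rightarrow> real" where
  "D_nu \<nu> q = 9*q - 9 * q powr (\<nu>+2) + q powr (\<nu>+3) - 10*q^2 + 9"

definition q1_star :: "real \<Rightarrow> real \<Rightarrow> real" where
  "q1_star \<nu> q = (q^3 + 2*q^2 + 2*q + 1) * D_nu \<nu> q / (a_nu \<nu> q + b_nu \<nu> q)"

end

theory Submission
  imports Defs "HOL-Computational_Algebra.Fundamental_Theorem_Algebra"
begin

text \<open>
  Put \<open>a = q powr (\<nu> + 1)\<close> and \<open>w = a z\<^sup>2 / 4\<close>. Then \<open>g(z) = z \<Phi>(w)\<close> and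
  \<open>z g'(z) / g(z) = H(w) / \<Phi>(w)\<close> with entire functions \<open>\<Phi>\<close> and \<open>H = \<Phi> + 2 w \<Phi>'\<close>.
  Hadamard's factorization is avoided by approximation: \<open>\<Phi>\<close> is the limit of \<open>q\<close>-Laguerre
  polynomials \<open>P\<^sub>N\<close>, whose three-term recurrence shows that all their roots are positive reals.
  The same then holds for \<open>Q\<^sub>N = P\<^sub>N + 2 w P\<^sub>N'\<close>. If \<open>1 / U\<close> is the smallest root of \<open>Q\<^sub>N\<close>, partial
  fractions give \<open>\<bar>P\<^sub>N\<bar> \<ge> 1 / 2\<close> and \<open>Re (Q\<^sub>N / P\<^sub>N) \<ge> 1 - \<bar>w\<bar> U\<close> for \<open>\<bar>w\<bar> U \<le> 1\<close>, and
  every other root of \<open>Q\<^sub>N\<close> is at least three times as large. With \<open>s\<^sub>k\<close> the sum of the \<open>k\<close>-th powers of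
  the reciprocal roots, this yields the quantitative Euler-Rayleigh inequalities
  \<open>U\<^sup>k \<le> s\<^sub>k\<close> and \<open>2 / 3 U (s\<^sub>k - U\<^sup>k) \<le> U s\<^sub>k - s\<^sub>k\<^sub>+\<^sub>1\<close>, which survive the passage to the limit
  along a subsequence. They become strict there because \<open>s\<^sub>2 < s\<^sub>1\<^sup>2\<close> and \<open>s\<^sub>4 < s\<^sub>2\<^sup>2\<close>
  can be read off from the Taylor coefficients of \<open>H\<close>.
\<close>

section \<open>Polynomials with positive roots\<close>

text \<open>The fundamental theorem of algebra supplies a root \<open>r\<close>. It is split off as
  \<open>1 - z / r\<close> rather than \<open>z - r\<close>, so the cofactor again has constant term
  1 and the induction continues. The \<open>v i\<close> are the reciprocal roots with
  multiplicity.\<close>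

lemma poly_positive_roots_factorization:
  fixes p :: "complex poly"
  assumes "poly p 0 = 1" and "\<And>z. poly p z = 0 \<Longrightarrow> Im z = 0 \<and> 0 < Re z"
  shows "\<exists>n v. (\<forall>i<(n::nat). 0 < v i) \<and> p = (\<Prod>i<n. [:1, - complex_of_real (v i):])"
  using assms
proof (induction "degree p" arbitrary: p)
  case 0
  then obtain c where "p = [:c:]" by (metis degree_eq_zeroE)
  with 0 show ?case by (intro exI[of _ 0]) (auto simp: one_pCons)
next
  case (Suc d)
  from Suc(2) have "\<not> constant (poly p)" by (simp add: constant_degree)
  then obtain r where r: "poly p r = 0" using fundamental_theorem_of_algebra by blast
  define x where "x = Re r"
  from Suc.prems(2)[OF r] have x: "r = complex_of_real x" "0 < x"
    by (auto simp: x_def complex_eq_iff)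
  from r obtain s where s: "p = [:-r, 1:] * s" by (metis poly_eq_0_iff_dvd dvdE)
  define t where "t = smult (- r) s"
  have pt: "p = [:1, - complex_of_real (1 / x):] * t"
  proof -
    have "[:-r, 1:] = smult (-r) [:1, - complex_of_real (1 / x):]"
      using x by simp
    thus ?thesis by (simp only: s t_def mult_smult_left mult_smult_right)
  qed
  have "t \<noteq> 0" using pt Suc.prems(1) by auto
  hence "degree p = degree [:1, - complex_of_real (1 / x):] + degree t"
    unfolding pt using x by (intro degree_mult_eq) auto
  hence "degree p = Suc (degree t)" using x by simp
  hence d: "d = degree t" using Suc(2) by simp
  have "poly t 0 = 1" using Suc.prems(1) by (simp add: pt)
  moreover have "Im z = 0 \<and> 0 < Re z" if "poly t z = 0" for z
    using that Suc.prems(2)[of z] by (simp add: pt)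
  ultimately have "\<exists>n v. (\<forall>i<(n::nat). 0 < v i) \<and> t = (\<Prod>i<n. [:1, - complex_of_real (v i):])"
    by (rule Suc(1)[OF d])
  then obtain n :: nat and v where nv: "\<forall>i<n. 0 < v i" "t = (\<Prod>i<n. [:1, - complex_of_real (v i):])"
    by blast
  show ?case
  proof (intro exI[of _ "Suc n"] exI[of _ "v(n := 1 / x)"] conjI)
    show "\<forall>i<Suc n. 0 < (v(n := 1 / x)) i" using nv(1) x by (auto simp: less_Suc_eq)
    have "(\<Prod>i<n. [:1, - complex_of_real ((v(n := 1 / x)) i):]) = t"
      unfolding nv(2) by (intro prod.cong) auto
    thus "p = (\<Prod>i<Suc n. [:1, - complex_of_real ((v(n := 1 / x)) i):])"
      by (simp add: pt mult.commute)
  qed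
qed

text \<open>The coefficients are the signed elementary symmetric functions. Adjoining a factor
  subtracts \<open>v x\<close> times the previous coefficient from each coefficient and adds one
  term to each power sum; ring arithmetic shows that the identities persist.\<close>

lemma newton_identities:
  fixes v :: "'i \<Rightarrow> 'a :: field_char_0"
  assumes "finite I"
  defines "p \<equiv> (\<Prod>i\<in>I. [:1, - v i:])"
  defines "s \<equiv> \<lambda>k. \<Sum>i\<in>I. v i ^ k"
  shows "coeff p 0 = 1" "s 1 = - coeff p 1"
    "s 2 = coeff p 1 ^ 2 - 2 * coeff p 2"
    "s 3 = - (coeff p 1 ^ 3) + 3 * coeff p 1 * coeff p 2 - 3 * coeff p 3"
    "s 4 = coeff p 1 ^ 4 - 4 * coeff p 1 ^ 2 * coeff p 2 + 2 * coeff p 2 ^ 2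
       + 4 * coeff p 1 * coeff p 3 - 4 * coeff p 4"
proof -
  have "coeff p 0 = 1 \<and> s 1 = - coeff p 1 \<and>
    s 2 = coeff p 1 ^ 2 - 2 * coeff p 2 \<and>
    s 3 = - (coeff p 1 ^ 3) + 3 * coeff p 1 * coeff p 2 - 3 * coeff p 3 \<and>
    s 4 = coeff p 1 ^ 4 - 4 * coeff p 1 ^ 2 * coeff p 2 + 2 * coeff p 2 ^ 2
       + 4 * coeff p 1 * coeff p 3 - 4 * coeff p 4"
    unfolding p_def s_def using assms(1)
  proof (induction I)
    case empty
    show ?case by simp
  next
    case (insert x I)
    define r where "r = (\<Prod>i\<in>I. [:1, - v i:])"
    have c: "coeff ([:1, - v x:] * r) (Suc k) = coeff r (Suc k) - v x * coeff r k" for k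
      by simp
    have c1: "coeff ([:1, - v x:] * r) 1 = coeff r 1 - v x * coeff r 0"
      and c2: "coeff ([:1, - v x:] * r) 2 = coeff r 2 - v x * coeff r 1"
      and c3: "coeff ([:1, - v x:] * r) 3 = coeff r 3 - v x * coeff r 2"
      and c4: "coeff ([:1, - v x:] * r) 4 = coeff r 4 - v x * coeff r 3"
      using c[of 0] c[of 1] c[of 2] c[of 3] by (simp_all add: numeral_eq_Suc)
    have c0: "coeff ([:1, - v x:] * r) 0 = coeff r 0" by simp
    note IH = insert.IH[folded r_def]
    have P: "(\<Prod>i\<in>insert x I. [:1, - v i:]) = [:1, - v x:] * r"
      using insert.hyps by (simp add: r_def)
    have S: "(\<Sum>i\<in>insert x I. v i ^ k) = v x ^ k + (\<Sum>i\<in>I. v i ^ k)" for k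
      using insert.hyps by simp
    from IH have r0: "coeff r 0 = 1" by blast
    show ?case
      unfolding P S c0 c1 c2 c3 c4 r0 using IH
      by (simp add: algebra_simps power2_eq_square power3_eq_cube power4_eq_xxxx del: One_nat_def)
  qed
  thus "coeff p 0 = 1" "s 1 = - coeff p 1"
    "s 2 = coeff p 1 ^ 2 - 2 * coeff p 2"
    "s 3 = - (coeff p 1 ^ 3) + 3 * coeff p 1 * coeff p 2 - 3 * coeff p 3"
    "s 4 = coeff p 1 ^ 4 - 4 * coeff p 1 ^ 2 * coeff p 2 + 2 * coeff p 2 ^ 2
       + 4 * coeff p 1 * coeff p 3 - 4 * coeff p 4"
    by blast+
qed

text \<open>The value of \<open>star_poly p\<close> at \<open>z\<^sup>2\<close> is the derivative of \<open>z p(z\<^sup>2)\<close>.\<close>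

definition star_poly :: "'a::field poly \<Rightarrow> 'a poly" where
  "star_poly p = p + [:0, 2:] * pderiv p"

lemma coeff_star_poly:
  fixes p :: "'a::field_char_0 poly"
  shows "coeff (star_poly p) k = (2 * of_nat k + 1) * coeff p k"
  by (cases k) (auto simp: star_poly_def coeff_pderiv algebra_simps)

text \<open>Logarithmic differentiation: \<open>star_poly p / p = 1 + 2 z p' / p\<close>, and
  \<open>p' / p\<close> is the sum of the \<open>- v i / (1 - v i * z)\<close>.\<close>

lemma poly_star_poly_prod:
  fixes v :: "'i \<Rightarrow> complex"
  assumes "finite I" "\<And>i. i \<in> I \<Longrightarrow> 1 - v i * z \<noteq> 0"
  shows "poly (star_poly (\<Prod>i\<in>I. [:1, - v i:])) z
    = (\<Prod>i\<in>I. 1 - v i * z) * (1 - 2 * (\<Sum>i\<in>I. v i * z / (1 - v i * z)))"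
proof -
  let ?p = "\<Prod>i\<in>I. [:1, - v i:]"
  have p: "poly ?p = (\<lambda>w. \<Prod>i\<in>I. 1 - v i * w)"
    by (rule ext) (simp add: poly_prod algebra_simps)
  have "((\<lambda>w. \<Prod>i\<in>I. 1 - v i * w) has_field_derivative
      (\<Prod>i\<in>I. 1 - v i * z) * (\<Sum>i\<in>I. - v i / (1 - v i * z))) (at z)"
    by (rule has_field_derivative_prod') (use assms in \<open>auto intro!: derivative_eq_intros\<close>)
  moreover have "(poly ?p has_field_derivative poly (pderiv ?p) z) (at z)"
    by (rule poly_DERIV)
  ultimately have "poly (pderiv ?p) z = (\<Prod>i\<in>I. 1 - v i * z) * (\<Sum>i\<in>I. - v i / (1 - v i * z))"
    unfolding p using DERIV_unique by blast
  thus ?thesis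
    by (simp add: star_poly_def p algebra_simps sum_distrib_left sum_negf sum_divide_distrib)
qed

text \<open>At a root off the positive axis no factor vanishes, so the terms
  \<open>v i * z / (1 - v i * z)\<close> sum to 1/2. The imaginary part of the sum is
  \<open>Im z\<close> times a positive number, which forces \<open>z\<close> to be real; for
  \<open>Re z \<le> 0\<close> every term is nonpositive, a contradiction.\<close>

lemma star_poly_positive_roots:
  fixes v :: "'i \<Rightarrow> real"
  assumes "finite I" "\<And>i. i \<in> I \<Longrightarrow> 0 < v i"
    and "poly (star_poly (\<Prod>i\<in>I. [:1, - complex_of_real (v i):])) z = 0"
  shows "Im z = 0 \<and> 0 < Re z"
proof -
  let ?V = "\<lambda>i. complex_of_real (v i)"
  have aux: "z \<noteq> 0"
    using assms(3) by (auto simp: star_poly_def poly_prod)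
  have im: "Im (?V i * z / (1 - ?V i * z)) = v i * Im z / cmod (1 - ?V i * z) ^ 2" for i
    unfolding Im_divide cmod_power2 by (simp add: power2_eq_square algebra_simps)
  have re: "Re (?V i * z / (1 - ?V i * z)) = (v i * Re z * (1 - v i * Re z) - (v i * Im z)^2) / cmod (1 - ?V i * z) ^ 2" for i
    unfolding Re_divide cmod_power2 by (simp add: power2_eq_square algebra_simps)
  show ?thesis
  proof (rule ccontr)
    assume c: "\<not> ?thesis"
    have nz: "1 - ?V i * z \<noteq> 0" if "i \<in> I" for i
    proof
      assume "1 - ?V i * z = 0"
      hence "?V i * z = 1" by simp
      hence "v i * Re z = 1 \<and> v i * Im z = 0" by (auto simp: complex_eq_iff)
      hence "0 < v i * Re z" "Im z = 0" using assms(2)[OF that] by auto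
      with c zero_less_mult_pos[OF _ assms(2)[OF that]] show False by blast
    qed
    have "(\<Prod>i\<in>I. 1 - ?V i * z) \<noteq> 0" using nz assms(1) by simp
    with assms(3) poly_star_poly_prod[of I ?V z, OF assms(1) nz]
    have S: "2 * (\<Sum>i\<in>I. ?V i * z / (1 - ?V i * z)) = 1" by auto
    have "2 * (\<Sum>i\<in>I. Im (?V i * z / (1 - ?V i * z))) = 0"
      using arg_cong[OF S, of Im] by simp
    hence "(\<Sum>i\<in>I. v i * Im z / cmod (1 - ?V i * z) ^ 2) = 0" by (simp only: im)
    hence "Im z * (\<Sum>i\<in>I. v i / cmod (1 - ?V i * z) ^ 2) = 0"
      by (simp add: sum_distrib_left algebra_simps)
    moreover have "I \<noteq> {}" using S by auto
    hence "0 < (\<Sum>i\<in>I. v i / cmod (1 - ?V i * z) ^ 2)"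
      using assms(1,2) nz by (intro sum_pos) auto
    ultimately have Im: "Im z = 0" by simp
    with c have Re: "Re z \<le> 0" by auto
    have "Re (?V i * z / (1 - ?V i * z)) \<le> 0" if "i \<in> I" for i
    proof -
      have v0: "v i * Re z \<le> 0" using assms(2)[OF that] Re by (simp add: mult_nonneg_nonpos)
      have "v i * Re z * (1 - v i * Re z) \<le> 0"
        by (rule mult_nonpos_nonneg) (use v0 in linarith)+
      with v0 show ?thesis unfolding re Im by (intro divide_nonpos_nonneg) auto
    qed
    hence "(\<Sum>i\<in>I. Re (?V i * z / (1 - ?V i * z))) \<le> 0" by (rule sum_nonpos)
    with arg_cong[OF S, of Re] show False by simp
  qed
qed

section \<open>The smallest root of the associated polynomial\<close>

lemma norm_one_minus_of_real_mult_ge: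
  fixes z :: complex
  assumes "0 \<le> v" "v * cmod z \<le> 1"
  shows "1 - v * cmod z \<le> cmod (1 - of_real v * z)"
proof -
  have "cmod 1 - cmod (of_real v * z) \<le> cmod (1 - of_real v * z)"
    by (rule norm_triangle_ineq2)
  thus ?thesis using assms(1) by (simp add: norm_mult)
qed

text \<open>The Weierstrass product inequality; it turns a bound on a sum of reciprocal roots into a
  lower bound for the polynomial.\<close>

lemma one_minus_sum_le_prod:
  fixes t :: "'i \<Rightarrow> real"
  assumes "finite I" "\<And>i. i \<in> I \<Longrightarrow> 0 \<le> t i \<and> t i \<le> 1"
  shows "1 - (\<Sum>i\<in>I. t i) \<le> (\<Prod>i\<in>I. 1 - t i)"
  using assms
proof (induction I)
  case (insert x I)
  have "(\<Prod>i\<in>I. 1 - t i) \<le> 1" "0 \<le> (\<Prod>i\<in>I. 1 - t i)"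
    using insert.prems by (auto intro!: prod_le_1 prod_nonneg)
  hence "t x * (\<Prod>i\<in>I. 1 - t i) \<le> t x * 1"
    using insert.prems by (intro mult_left_mono) auto
  with insert show ?case by (simp add: algebra_simps)
qed auto

text \<open>\<open>v\<close> and \<open>u\<close> list the reciprocal roots of a polynomial and of
  its star polynomial, so a large value belongs to a small root. A nonempty \<open>I\<close>
  excludes the constant 1, whose star polynomial has no root.\<close>

locale star_factorization =
  fixes I :: "'i set" and J :: "'j set" and v :: "'i \<Rightarrow> real" and u :: "'j \<Rightarrow> real"
  assumes fin: "finite I" "finite J" and nonempty: "I \<noteq> {}"
    and v_pos: "\<And>i. i \<in> I \<Longrightarrow> 0 < v i" and u_pos: "\<And>j. j \<in> J \<Longrightarrow> 0 < u j"
    and star_eq: "star_poly (\<Prod>i\<in>I. [:1, - complex_of_real (v i):])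
      = (\<Prod>j\<in>J. [:1, - complex_of_real (u j):])"
begin

lemma star_prod:
  fixes z :: complex
  assumes "\<And>i. i \<in> I \<Longrightarrow> 1 - of_real (v i) * z \<noteq> 0"
  shows "(\<Prod>j\<in>J. 1 - of_real (u j) * z) =
    (\<Prod>i\<in>I. 1 - of_real (v i) * z) * (1 - 2 * (\<Sum>i\<in>I. of_real (v i) * z / (1 - of_real (v i) * z)))"
  using poly_star_poly_prod[OF fin(1), of "\<lambda>i. of_real (v i)", OF assms]
  by (simp add: star_eq poly_prod algebra_simps)

lemma star_prod_real:
  fixes s :: real
  assumes "\<And>i. i \<in> I \<Longrightarrow> 1 - v i * s \<noteq> 0"
  shows "(\<Prod>j\<in>J. 1 - u j * s) =
    (\<Prod>i\<in>I. 1 - v i * s) * (1 - 2 * (\<Sum>i\<in>I. v i * s / (1 - v i * s)))"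
proof -
  have "1 - complex_of_real (v i) * of_real s \<noteq> 0" if "i \<in> I" for i
    using assms[OF that] by (metis of_real_1 of_real_diff of_real_eq_0_iff of_real_mult)
  from star_prod[OF this] have "complex_of_real (\<Prod>j\<in>J. 1 - u j * s) =
    complex_of_real ((\<Prod>i\<in>I. 1 - v i * s) * (1 - 2 * (\<Sum>i\<in>I. v i * s / (1 - v i * s))))"
    by simp
  thus ?thesis by (simp only: of_real_eq_iff)
qed

text \<open>The star polynomial is 1 at 0 and nonpositive at a third of the smallest root of the
  original polynomial, so the intermediate value theorem puts one of its roots in between.\<close>

lemma ex_dominating: "\<exists>j\<in>J. \<forall>i\<in>I. 3 * v i \<le> u j"
proof -
  define m where "m = Max (v ` I)"
  have "m \<in> v ` I" unfolding m_def using fin nonempty by (intro Max_in) auto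
  then obtain i where i: "i \<in> I" "v i = m" by auto
  have m: "0 < m" "\<And>i. i \<in> I \<Longrightarrow> v i \<le> m"
    using i v_pos[of i] fin by (simp_all add: m_def)
  \<comment> \<open>Here the largest \<open>v i\<close> alone contributes (1/3) / (2/3) = 1/2 to the
    sum, just enough to make the bracket in \<open>star_prod_real\<close> nonpositive.\<close>
  define s where "s = 1 / (3 * m)"
  have s: "0 < s" "m * s = 1 / 3" using m by (auto simp: s_def)
  have v3: "v i * s \<le> 1 / 3" if "i \<in> I" for i
    using mult_right_mono[OF m(2)[OF that], of s] s by simp
  have nn: "0 \<le> v i * s / (1 - v i * s)" if "i \<in> I" for i
    using v_pos[OF that] v3[OF that] s by auto
  have "1 / 2 = v i * s / (1 - v i * s)" using i s by simp
  also have "\<dots> \<le> (\<Sum>i\<in>I. v i * s / (1 - v i * s))"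
    using nn fin i by (intro member_le_sum) auto
  finally have "1 - 2 * (\<Sum>i\<in>I. v i * s / (1 - v i * s)) \<le> 0" by simp
  moreover have "0 \<le> (\<Prod>i\<in>I. 1 - v i * s)" using v3 by (intro prod_nonneg) force
  ultimately have "(\<Prod>j\<in>J. 1 - u j * s) \<le> 0"
    using v3 by (subst star_prod_real) (force intro: mult_nonneg_nonpos)+
  moreover have "continuous_on {0..s} (\<lambda>s. \<Prod>j\<in>J. 1 - u j * s)"
    by (intro continuous_intros)
  ultimately obtain x where x: "0 \<le> x" "x \<le> s" "(\<Prod>j\<in>J. 1 - u j * x) = 0"
    using IVT2'[of "\<lambda>s. \<Prod>j\<in>J. 1 - u j * s" s 0 0] s by force
  then obtain j where j: "j \<in> J" "u j * x = 1" using fin by auto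
  have "3 * v i \<le> u j" if "i \<in> I" for i
  proof -
    have "u j * x \<le> u j * s" using x u_pos[OF j(1)] by (intro mult_left_mono) auto
    hence "1 \<le> u j * s" using j by simp
    hence "3 * m \<le> u j" using m by (simp add: s_def field_simps)
    thus ?thesis using m(2)[OF that] by simp
  qed
  with j show ?thesis by auto
qed

text \<open>An index is fixed, not merely the maximal value, so that exactly one factor can be
  removed from the product over \<open>J\<close> before the simplicity of the smallest root is
  known.\<close>

definition jmax :: 'j where "jmax = (SOME j. j \<in> J \<and> u j = Max (u ` J))"
definition umax :: real where "umax = u jmax"

lemma jmax: "jmax \<in> J" and u_le_umax: "\<And>j. j \<in> J \<Longrightarrow> u j \<le> umax"
  and v_le_umax: "\<And>i. i \<in> I \<Longrightarrow> 3 * v i \<le> umax" and umax_pos: "0 < umax"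
proof -
  have "J \<noteq> {}" using ex_dominating by auto
  hence "Max (u ` J) \<in> u ` J" using fin by (intro Max_in) auto
  hence "\<exists>j. j \<in> J \<and> u j = Max (u ` J)" by auto
  from someI_ex[OF this] have *: "jmax \<in> J" "u jmax = Max (u ` J)"
    by (auto simp: jmax_def)
  show "jmax \<in> J" by fact
  show **: "u j \<le> umax" if "j \<in> J" for j unfolding umax_def *(2) using fin that by auto
  show "3 * v i \<le> umax" if "i \<in> I" for i
    using ex_dominating ** that by force
  show "0 < umax" unfolding umax_def by (rule u_pos[OF *(1)])
qed

lemma v_mult_le:
  assumes "i \<in> I" "0 \<le> s" "s * umax \<le> 1"
  shows "v i * s \<le> 1 / 3"
proof -
  have "3 * v i * s \<le> umax * s" using v_le_umax[OF assms(1)] assms(2) by (intro mult_right_mono) auto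
  thus ?thesis using assms by (simp add: mult.commute)
qed

text \<open>At \<open>1 / umax\<close> the product over \<open>J\<close> vanishes while that over
  \<open>I\<close> does not, so the bracket in \<open>star_prod_real\<close> is 0.\<close>

lemma sum_at_smallest_root: "2 * (\<Sum>i\<in>I. v i * (1 / umax) / (1 - v i * (1 / umax))) = 1"
proof -
  have *: "v i * (1 / umax) \<le> 1 / 3" if "i \<in> I" for i
    using v_mult_le[OF that, of "1 / umax"] umax_pos by simp
  have "(\<Prod>j\<in>J. 1 - u j * (1 / umax)) = 0"
    using jmax umax_pos fin by (auto simp: umax_def)
  moreover have "(\<Prod>i\<in>I. 1 - v i * (1 / umax)) \<noteq> 0" using * fin by force
  ultimately show ?thesis using star_prod_real[of "1 / umax"] * by force
qed

text \<open>Each term is convex in \<open>s\<close> and vanishes at 0, so it lies below its chord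
  over \<open>[0, 1 / umax]\<close>; \<open>sum_at_smallest_root\<close> adds up the chords.\<close>

lemma sum_le:
  assumes "0 \<le> s" "s * umax \<le> 1"
  shows "2 * (\<Sum>i\<in>I. v i * s / (1 - v i * s)) \<le> s * umax"
proof -
  have "v i * s / (1 - v i * s) \<le> s * umax * (v i * (1 / umax) / (1 - v i * (1 / umax)))" if "i \<in> I" for i
  proof -
    have 1: "v i * (1 / umax) \<le> 1 / 3" using v_mult_le[OF that, of "1 / umax"] umax_pos by simp
    have "s \<le> 1 / umax" using assms umax_pos by (simp add: field_simps)
    hence "v i * s \<le> v i * (1 / umax)" using v_pos[OF that] by (intro mult_left_mono) auto
    hence "v i * s / (1 - v i * s) \<le> v i * s / (1 - v i * (1 / umax))"
      using 1 v_pos[OF that] assms by (intro divide_left_mono mult_pos_pos) (linarith | simp)+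
    also have "\<dots> = s * umax * (v i * (1 / umax) / (1 - v i * (1 / umax)))"
      using umax_pos by simp
    finally show ?thesis .
  qed
  hence "(\<Sum>i\<in>I. v i * s / (1 - v i * s)) \<le> s * umax * (\<Sum>i\<in>I. v i * (1 / umax) / (1 - v i * (1 / umax)))"
    unfolding sum_distrib_left by (rule sum_mono)
  also have "\<dots> = s * umax * (1 / 2)" using sum_at_smallest_root by simp
  finally show ?thesis by simp
qed

text \<open>The sum of the \<open>v i * s\<close> is dominated by the sum in \<open>sum_le\<close>,
  hence at most 1/2, and the Weierstrass inequality applies.\<close>

lemma prod_ge_half:
  assumes "s * umax \<le> 1" "0 \<le> s"
  shows "1 / 2 \<le> (\<Prod>i\<in>I. 1 - v i * s)"
proof -
  have le: "v i * s \<le> v i * s / (1 - v i * s)" and le3: "v i * s \<le> 1 / 3" and "0 \<le> v i * s" if "i \<in> I" for i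
  proof -
    show "v i * s \<le> 1 / 3" using v_mult_le[OF that] assms by simp
    show "0 \<le> v i * s" using assms v_pos[OF that] by simp
    thus "v i * s \<le> v i * s / (1 - v i * s)" using \<open>v i * s \<le> 1 / 3\<close>
      by (simp add: pos_le_divide_eq mult_left_le)
  qed
  have "2 * (\<Sum>i\<in>I. v i * s) \<le> 2 * (\<Sum>i\<in>I. v i * s / (1 - v i * s))"
    using le by (simp add: sum_mono)
  also have "\<dots> \<le> 1" using sum_le[of s] assms by linarith
  finally have "1 / 2 \<le> 1 - (\<Sum>i\<in>I. v i * s)" by simp
  also have "\<dots> \<le> (\<Prod>i\<in>I. 1 - v i * s)"
    using le3 \<open>\<And>i. i \<in> I \<Longrightarrow> 0 \<le> v i * s\<close> fin by (intro one_minus_sum_le_prod) force+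
  finally show ?thesis .
qed

text \<open>Each factor has modulus at least its value at the real point \<open>cmod z\<close>,
  which reduces both claims to the real estimates. The bound 1/2 does not depend on the degree and
  keeps the limit function from vanishing.\<close>

lemma starlike_bound:
  fixes z :: complex
  assumes "cmod z * umax \<le> 1"
  shows "1 / 2 \<le> cmod (\<Prod>i\<in>I. 1 - of_real (v i) * z)"
    and "1 - cmod z * umax \<le> Re ((\<Prod>j\<in>J. 1 - of_real (u j) * z) / (\<Prod>i\<in>I. 1 - of_real (v i) * z))"
proof -
  let ?s = "cmod z"
  have v3: "v i * ?s \<le> 1 / 3" if "i \<in> I" for i using v_mult_le[OF that] assms by simp
  have n: "1 - v i * ?s \<le> cmod (1 - of_real (v i) * z)" if "i \<in> I" for i
    using v3[OF that] v_pos[OF that] by (intro norm_one_minus_of_real_mult_ge) auto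
  have nz: "1 - of_real (v i) * z \<noteq> 0" if "i \<in> I" for i
    using n[OF that] v3[OF that] by auto
  have "1 / 2 \<le> (\<Prod>i\<in>I. 1 - v i * ?s)" using prod_ge_half assms by simp
  also have "\<dots> \<le> (\<Prod>i\<in>I. cmod (1 - of_real (v i) * z))"
    using n v3 by (intro prod_mono) force
  finally show "1 / 2 \<le> cmod (\<Prod>i\<in>I. 1 - of_real (v i) * z)" by (simp add: prod_norm)
  have "Re (of_real (v i) * z / (1 - of_real (v i) * z)) \<le> v i * ?s / (1 - v i * ?s)" if "i \<in> I" for i
  proof -
    have "Re (of_real (v i) * z / (1 - of_real (v i) * z)) \<le> cmod (of_real (v i) * z / (1 - of_real (v i) * z))"
      by (rule complex_Re_le_cmod)
    also have "\<dots> = v i * ?s / cmod (1 - of_real (v i) * z)"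
      using v_pos[OF that] by (simp add: norm_mult norm_divide)
    also have "\<dots> \<le> v i * ?s / (1 - v i * ?s)"
      using n[OF that] v3[OF that] v_pos[OF that]
      by (intro divide_left_mono mult_pos_pos) (linarith | simp)+
    finally show ?thesis .
  qed
  hence "(\<Sum>i\<in>I. Re (of_real (v i) * z / (1 - of_real (v i) * z))) \<le> (\<Sum>i\<in>I. v i * ?s / (1 - v i * ?s))"
    by (rule sum_mono)
  with sum_le[of ?s] assms
  have "1 - ?s * umax \<le> 1 - 2 * (\<Sum>i\<in>I. Re (of_real (v i) * z / (1 - of_real (v i) * z)))" by simp
  also have "\<dots> = Re (1 - 2 * (\<Sum>i\<in>I. of_real (v i) * z / (1 - of_real (v i) * z)))" by simp
  also have "1 - 2 * (\<Sum>i\<in>I. of_real (v i) * z / (1 - of_real (v i) * z)) =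
     (\<Prod>j\<in>J. 1 - of_real (u j) * z) / (\<Prod>i\<in>I. 1 - of_real (v i) * z)"
    using nz fin by (simp add: star_prod)
  finally show "1 - ?s * umax \<le> Re ((\<Prod>j\<in>J. 1 - of_real (u j) * z) / (\<Prod>i\<in>I. 1 - of_real (v i) * z))" .
qed

text \<open>Writing the 1 in the bracket as the sum at \<open>1 / umax\<close> exhibits the factor
  \<open>1 / umax - s\<close>, which cancels against \<open>1 - umax * s\<close>. What remains is
  visibly positive.\<close>

lemma cofactor_eq:
  assumes s: "0 < s" "\<And>i. i \<in> I \<Longrightarrow> v i * s < 1" and ne: "s * umax \<noteq> 1"
  shows "(\<Prod>j\<in>J-{jmax}. 1 - u j * s) = (\<Prod>i\<in>I. 1 - v i * s) *
    (2 / umax * (\<Sum>i\<in>I. v i / ((1 - v i * (1 / umax)) * (1 - v i * s))))"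
proof -
  let ?y = "1 / umax"
  have y: "v i * ?y \<le> 1 / 3" if "i \<in> I" for i
    using v_mult_le[OF that, of ?y] umax_pos by simp
  have "(1 - umax * s) * (\<Prod>j\<in>J-{jmax}. 1 - u j * s) = (\<Prod>j\<in>J. 1 - u j * s)"
    using jmax fin by (simp add: prod.remove umax_def)
  also have "\<dots> = (\<Prod>i\<in>I. 1 - v i * s) * (1 - 2 * (\<Sum>i\<in>I. v i * s / (1 - v i * s)))"
    using s by (intro star_prod_real) force
  also have "1 - 2 * (\<Sum>i\<in>I. v i * s / (1 - v i * s)) =
      2 * (\<Sum>i\<in>I. v i * ?y / (1 - v i * ?y)) - 2 * (\<Sum>i\<in>I. v i * s / (1 - v i * s))"
    by (simp only: sum_at_smallest_root)
  also have "\<dots> = 2 * (\<Sum>i\<in>I. v i * ?y / (1 - v i * ?y) - v i * s / (1 - v i * s))"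
    by (simp add: sum_subtractf algebra_simps)
  also have "(\<Sum>i\<in>I. v i * ?y / (1 - v i * ?y) - v i * s / (1 - v i * s)) =
     (\<Sum>i\<in>I. (?y - s) * (v i / ((1 - v i * ?y) * (1 - v i * s))))"
  proof (intro sum.cong refl)
    fix i assume i: "i \<in> I"
    define Y where "Y = ?y"
    have "1 - v i * Y \<noteq> 0" "1 - v i * s \<noteq> 0" using y[OF i] s(2)[OF i] by (auto simp: Y_def)
    thus "v i * ?y / (1 - v i * ?y) - v i * s / (1 - v i * s) = (?y - s) * (v i / ((1 - v i * ?y) * (1 - v i * s)))"
      unfolding Y_def[symmetric] by (simp add: field_simps)
  qed
  also have "\<dots> = (?y - s) * (\<Sum>i\<in>I. v i / ((1 - v i * ?y) * (1 - v i * s)))"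
    by (simp add: sum_distrib_left)
  also have "?y - s = (1 - umax * s) * ?y" using umax_pos by (simp add: field_simps)
  finally have "(1 - umax * s) * (\<Prod>j\<in>J-{jmax}. 1 - u j * s) = (1 - umax * s) * ((\<Prod>i\<in>I. 1 - v i * s) *
    (2 / umax * (\<Sum>i\<in>I. v i / ((1 - v i * (1 / umax)) * (1 - v i * s)))))"
    by (simp only: divide_inverse mult_1_left mult_ac)
  moreover have "1 - umax * s \<noteq> 0" using ne by (simp add: mult.commute)
  ultimately show ?thesis by (meson mult_left_cancel)
qed

text \<open>The quotient of the two products is strictly decreasing up to the first pole, so the
  smallest zero of the numerator is simple and is the only one there.\<close>

lemma other_u_le:
  assumes j: "j \<in> J" "j \<noteq> jmax"
  shows "3 * u j \<le> umax"
proof (rule ccontr)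
  assume "\<not> 3 * u j \<le> umax"
  hence *: "umax < 3 * u j" by simp
  define s where "s = 1 / u j"
  have uj: "0 < u j" using u_pos j by simp
  have s: "0 < s" using uj by (simp add: s_def)
  have vs: "v i * s < 1" if "i \<in> I" for i
    using v_le_umax[OF that] * uj by (simp add: s_def field_simps)
  define K where "K = (\<lambda>s. \<Prod>j\<in>J-{jmax}. 1 - u j * s)"
  define L where "L = (\<lambda>s. (\<Prod>i\<in>I. 1 - v i * s) *
    (2 / umax * (\<Sum>i\<in>I. v i / ((1 - v i * (1 / umax)) * (1 - v i * s)))))"
  have y: "v i * (1 / umax) \<le> 1 / 3" if "i \<in> I" for i
    using v_mult_le[OF that, of "1 / umax"] umax_pos by simp
  have y': "1 - v i * (1 / umax) > 0" if "i \<in> I" for i using y[OF that] by linarith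
  have "K s = 0" using j fin uj by (auto simp: K_def s_def)
  have "0 < (\<Sum>i\<in>I. v i / ((1 - v i * (1 / umax)) * (1 - v i * s)))"
    using fin nonempty vs y' v_pos by (intro sum_pos divide_pos_pos mult_pos_pos) auto
  moreover have "0 < (\<Prod>i\<in>I. 1 - v i * s)" using vs by (intro prod_pos) auto
  ultimately have "0 < L s" using umax_pos by (simp add: L_def)
  have "isCont K s" unfolding K_def by (intro continuous_intros)
  have "isCont L s" unfolding L_def
    using vs y' umax_pos by (intro continuous_intros) (auto simp: less_le)
  \<comment> \<open>If \<open>u j = umax\<close>, then \<open>s\<close> is the very point excluded
    in \<open>cofactor_eq\<close>. The identity holds at all nearby points and extends to
    \<open>s\<close> by continuity, which also rules out a double smallest root.\<close>
  have "eventually (\<lambda>x. K x = L x) (at s)"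
  proof -
    have "eventually (\<lambda>x. 0 < x) (at s)"
      using s by (intro order_tendstoD(1)[OF tendsto_ident_at])
    moreover have "eventually (\<lambda>x. \<forall>i\<in>I. v i * x < 1) (at s)"
      using fin vs by (intro eventually_ball_finite ballI order_tendstoD(2)[where y = "v _ * s"] tendsto_intros) auto
    moreover have "eventually (\<lambda>x. x * umax \<noteq> 1) (at s)"
    proof (cases "s * umax = 1")
      case True
      have "eventually (\<lambda>x. x \<noteq> s) (at s)" by (simp add: eventually_at_filter)
      thus ?thesis by eventually_elim (use True umax_pos in \<open>metis less_irrefl mult_cancel_right\<close>)
    next
      case False
      thus ?thesis by (intro tendsto_imp_eventually_ne[where c = "s * umax"] tendsto_intros)
    qed
    ultimately show ?thesis
      by eventually_elim (unfold K_def L_def, rule cofactor_eq, auto)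
  qed
  hence "K s = L s"
    using \<open>isCont K s\<close> \<open>isCont L s\<close> unfolding isCont_def
    by (metis tendsto_cong tendsto_unique trivial_limit_at)
  with \<open>K s = 0\<close> \<open>0 < L s\<close> show False by simp
qed

text \<open>The right side is the sum of \<open>u j ^ k * (umax - u j)\<close>, where
  \<open>jmax\<close> contributes 0 and every other difference is at least
  \<open>2 / 3 * umax\<close> by \<open>other_u_le\<close>.\<close>

lemma power_sum_gap:
  "2 / 3 * umax * ((\<Sum>j\<in>J. u j ^ k) - umax ^ k) \<le> umax * (\<Sum>j\<in>J. u j ^ k) - (\<Sum>j\<in>J. u j ^ Suc k)"
proof -
  have "u j ^ k * (2 / 3 * umax) \<le> u j ^ k * (umax - u j)" if "j \<in> J - {jmax}" for j
    using other_u_le[of j] u_pos[of j] that by (intro mult_left_mono) auto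
  hence "(\<Sum>j\<in>J-{jmax}. u j ^ k * (2 / 3 * umax)) \<le> (\<Sum>j\<in>J-{jmax}. u j ^ k * (umax - u j))"
    by (rule sum_mono)
  moreover have "(\<Sum>j\<in>J-{jmax}. u j ^ k * (umax - u j)) = umax * (\<Sum>j\<in>J. u j ^ k) - (\<Sum>j\<in>J. u j ^ Suc k)"
  proof -
    have "(\<Sum>j\<in>J-{jmax}. u j ^ k * (umax - u j)) = (\<Sum>j\<in>J. u j ^ k * (umax - u j))"
      using jmax fin by (simp add: sum.remove umax_def)
    thus ?thesis by (simp add: algebra_simps sum_distrib_left sum_subtractf)
  qed
  moreover have "(\<Sum>j\<in>J-{jmax}. u j ^ k * (2 / 3 * umax)) = 2 / 3 * umax * ((\<Sum>j\<in>J. u j ^ k) - umax ^ k)"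
    using jmax fin by (subst sum_distrib_right [symmetric]) (simp add: sum.remove umax_def)
  ultimately show ?thesis by simp
qed

lemma umax_power_le: "umax ^ k \<le> (\<Sum>j\<in>J. u j ^ k)"
  unfolding umax_def using jmax fin u_pos by (intro member_le_sum) (auto simp: less_imp_le)

end

section \<open>The \<open>q\<close>-Laguerre polynomials\<close>

text \<open>For \<open>k \<le> N\<close> this is \<open>(q;q)_N / (q;q)_(N-k)\<close>; dividing by
  \<open>q ^ i\<close> avoids truncated subtraction, and the factor \<open>i = N\<close> gives 0 for
  \<open>k > N\<close>.\<close>

definition trunc_coeff :: "real \<Rightarrow> nat \<Rightarrow> nat \<Rightarrow> real" where
  "trunc_coeff q N k = (\<Prod>i<k. 1 - q ^ N / q ^ i)"

text \<open>The power \<open>a ^ k\<close> contained in \<open>q powr (k * (k + \<nu>))\<close> is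
  moved into the variable \<open>w\<close>, which leaves \<open>q ^ (k * (k - 1))\<close>.\<close>

definition jcoeff :: "real \<Rightarrow> real \<Rightarrow> nat \<Rightarrow> real" where
  "jcoeff a q k = q ^ (k * (k - 1)) / (qpoch q q k * qpoch a q k)"

text \<open>The terminating 1phi1 series of the \<open>q\<close>-Laguerre polynomial, normalised to
  the value 1 at 0 and with the variable rescaled by \<open>a\<close>.\<close>

definition q_laguerre :: "real \<Rightarrow> real \<Rightarrow> nat \<Rightarrow> 'a::real_normed_field poly" where
  "q_laguerre a q N = (\<Sum>k\<le>N. monom (of_real ((-1) ^ k * (trunc_coeff q N k * jcoeff a q k))) k)"

context
  fixes a q :: real
  assumes q: "0 < q" "q < 1" and a: "0 < a" "a < 1"
begin

lemma mult_power_less_one: "0 < c \<Longrightarrow> c < 1 \<Longrightarrow> 0 \<le> c * q ^ k \<and> c * q ^ k < 1"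
proof -
  assume c: "0 < c" "c < 1"
  hence "c * q ^ k \<le> c * 1" using q by (intro mult_left_mono power_le_one) auto
  hence "c * q ^ k < 1" using c by linarith
  with c q show ?thesis by simp
qed

lemma qpoch_pos: "0 < c \<Longrightarrow> c < 1 \<Longrightarrow> 0 < qpoch c q k"
  unfolding qpoch_def using mult_power_less_one by (intro prod_pos) auto

lemma jcoeff_0 [simp]: "jcoeff a q 0 = 1"
  by (simp add: jcoeff_def qpoch_def)

lemma trunc_coeff_0 [simp]: "trunc_coeff q N 0 = 1"
  by (simp add: trunc_coeff_def)

lemma jcoeff_pos: "0 < jcoeff a q k"
  unfolding jcoeff_def using q a qpoch_pos by simp

lemma jcoeff_Suc: "jcoeff a q (Suc k) * ((1 - q ^ Suc k) * (1 - a * q ^ k)) = jcoeff a q k * q ^ (2 * k)"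
proof -
  have "Suc k * (Suc k - 1) = k * (k - 1) + 2 * k" by (cases k) (auto simp: algebra_simps)
  moreover have "qpoch c q (Suc k) = qpoch c q k * (1 - c * q ^ k)" for c
    by (simp add: qpoch_def)
  moreover have "1 - q * q ^ k \<noteq> 0" "1 - a * q ^ k \<noteq> 0"
    using mult_power_less_one[of q k] mult_power_less_one[of a k] q a by auto
  ultimately show ?thesis
    using qpoch_pos[of q k] qpoch_pos[of a k] q a
    by (simp add: jcoeff_def power_add mult_2 divide_simps)
qed

lemma trunc_coeff_eq_0: "N < k \<Longrightarrow> trunc_coeff q N k = 0"
  unfolding trunc_coeff_def using q by (intro prod_zero) auto

lemma trunc_coeff_pos_le: 
  assumes "k \<le> N" shows "0 < trunc_coeff q N k" "trunc_coeff q N k \<le> 1"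
proof -
  have "0 < q ^ N / q ^ i \<and> q ^ N / q ^ i < 1" if "i < k" for i
    using q that assms power_strict_decreasing[of i N q] by simp
  thus "0 < trunc_coeff q N k" "trunc_coeff q N k \<le> 1"
    unfolding trunc_coeff_def by (auto intro!: prod_pos prod_le_1 simp: less_imp_le)
qed

lemma trunc_coeff_bounds: "0 \<le> trunc_coeff q N k" "trunc_coeff q N k \<le> 1"
  using trunc_coeff_eq_0[of N k] trunc_coeff_pos_le[of k N] by (cases "k \<le> N"; simp)+

lemma trunc_coeff_tendsto: "(\<lambda>N. trunc_coeff q N k) \<longlonglongrightarrow> 1"
proof -
  have "(\<lambda>N. trunc_coeff q N k) \<longlonglongrightarrow> (\<Prod>i<k. 1 - 0 / q ^ i)"
    unfolding trunc_coeff_def using q by (intro tendsto_intros LIMSEQ_realpow_zero) auto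
  thus ?thesis by simp
qed

lemma coeff_q_laguerre:
  "coeff (q_laguerre a q N) k = of_real ((-1) ^ k * (trunc_coeff q N k * jcoeff a q k))"
  by (simp add: q_laguerre_def coeff_sum trunc_coeff_eq_0)

text \<open>All three truncation coefficients are multiples of \<open>M\<close> once expressed by
  \<open>Q = q ^ n\<close> and \<open>t = 1 / q ^ l\<close>, and the claim becomes a polynomial
  identity. The right side is shaped so that \<open>jcoeff_Suc\<close> turns it into the coefficient
  of degree \<open>k - 1\<close>.\<close>

lemma trunc_coeff_recurrence:
  fixes n k :: nat
  assumes k: "0 < k"
  defines "M \<equiv> trunc_coeff q n (k - 1)"
  shows "(1 - a * q ^ n) * trunc_coeff q (Suc n) k
       - (1 - q ^ Suc n + q - a * q ^ n) * trunc_coeff q n k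
       + q * (1 - q ^ n) * trunc_coeff q (n - 1) k
     = M * q ^ (2 * n) * ((1 - q ^ k) * (1 - a * q ^ (k - 1)) / q ^ (2 * (k - 1)))"
proof -
  obtain l where l: "k = Suc l" using k by (cases k) auto
  define Q where "Q = q ^ n"
  define t where "t = 1 / q ^ l"
  have M: "M = trunc_coeff q n l" by (simp add: M_def l)
  have q0: "q \<noteq> 0" "q ^ l \<noteq> 0" using q by auto
  have c1: "trunc_coeff q n k = M * (1 - Q * t)"
    by (simp add: M l trunc_coeff_def Q_def t_def)
  have c2: "trunc_coeff q (Suc n) k = (1 - q * Q) * M"
  proof -
    have "trunc_coeff q (Suc n) (Suc l) = (1 - q ^ Suc n) * (\<Prod>i<l. 1 - q ^ Suc n / q ^ Suc i)"
      unfolding trunc_coeff_def by (subst prod.lessThan_Suc_shift) simp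
    also have "(\<Prod>i<l. 1 - q ^ Suc n / q ^ Suc i) = M"
      unfolding M trunc_coeff_def using q by (intro prod.cong) auto
    finally show ?thesis by (simp add: l Q_def)
  qed
  \<comment> \<open>For \<open>n = 0\<close> the index \<open>n - 1\<close> is truncated, but then
    \<open>1 - Q = 0\<close>, and the right side vanishes as well.\<close>
  have c3: "(1 - Q) * trunc_coeff q (n - 1) k = M * (1 - Q * t) * (1 - Q * t / q)"
  proof (cases n)
    case 0
    show ?thesis
    proof (cases l)
      case 0 thus ?thesis using \<open>n = 0\<close> by (simp add: Q_def t_def)
    next
      case (Suc l')
      hence "M = 0" using \<open>n = 0\<close> by (simp add: M trunc_coeff_eq_0)
      thus ?thesis using \<open>n = 0\<close> by (simp add: Q_def)
    qed
  next
    case (Suc m)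
    have "trunc_coeff q n (Suc k) = (1 - q ^ n) * (\<Prod>i<k. 1 - q ^ n / q ^ Suc i)"
      unfolding trunc_coeff_def by (subst prod.lessThan_Suc_shift) simp
    also have "(\<Prod>i<k. 1 - q ^ n / q ^ Suc i) = trunc_coeff q (n - 1) k"
      unfolding trunc_coeff_def Suc using q by (intro prod.cong) auto
    finally have "(1 - Q) * trunc_coeff q (n - 1) k = trunc_coeff q n (Suc k)" by (simp add: Q_def)
    also have "\<dots> = trunc_coeff q n k * (1 - Q / q ^ k)"
      by (simp add: trunc_coeff_def Q_def)
    also have "Q / q ^ k = Q * t / q" by (simp add: l t_def)
    finally show ?thesis by (simp add: c1)
  qed
  have t: "q ^ l = 1 / t" "t \<noteq> 0" using q0 by (auto simp: t_def)
  have "(1 - a * q ^ n) * trunc_coeff q (Suc n) k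
       - (1 - q ^ Suc n + q - a * q ^ n) * trunc_coeff q n k
       + q * (1 - q ^ n) * trunc_coeff q (n - 1) k
     = (1 - a * Q) * ((1 - q * Q) * M) - (1 - q * Q + q - a * Q) * (M * (1 - Q * t))
      + q * (M * (1 - Q * t) * (1 - Q * t / q))"
    unfolding c1 c2 mult.assoc[of q] using c3 by (simp add: Q_def)
  also have "q * (M * (1 - Q * t) * (1 - Q * t / q)) = M * (1 - Q * t) * (q - Q * t)"
    using q0 by (simp add: field_simps)
  also have "(1 - a * Q) * ((1 - q * Q) * M) - (1 - q * Q + q - a * Q) * (M * (1 - Q * t))
      + M * (1 - Q * t) * (q - Q * t) = M * Q\<^sup>2 * ((t - q) * (t - a))"
    by (simp add: algebra_simps power2_eq_square)
  also have "(t - q) * (t - a) = (1 - q / t) * (1 - a / t) * t\<^sup>2"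
    using t by (simp add: field_simps power2_eq_square)
  also have "\<dots> = (1 - q ^ k) * (1 - a * q ^ (k - 1)) / q ^ (2 * (k - 1))"
    using t by (simp add: l power_mult_distrib power_mult power_divide mult.commute[of 2])
  also have "Q\<^sup>2 = q ^ (2 * n)" by (simp add: Q_def power_mult mult.commute[of 2])
  finally show ?thesis .
qed

text \<open>Comparison of coefficients. The factor \<open>1 - q ^ n\<close> makes the formula valid
  for \<open>n = 0\<close> too; the signs of the coefficients are what the location of the roots
  rests on.\<close>

lemma q_laguerre_recurrence:
  "of_real (1 - a * q ^ n) * poly (q_laguerre a q (Suc n)) z =
     (of_real (1 - q ^ Suc n + q - a * q ^ n) - of_real (q ^ (2 * n)) * z) * poly (q_laguerre a q n) z
     - of_real (q * (1 - q ^ n)) * poly (q_laguerre a q (n - 1)) (z :: 'a :: {real_normed_field})"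
proof -
  define c where "c = (\<lambda>N k. (-1) ^ k * (trunc_coeff q N k * jcoeff a q k))"
  have rec: "(1 - a * q ^ n) * c (Suc n) (Suc l) = (1 - q ^ Suc n + q - a * q ^ n) * c n (Suc l)
      - q ^ (2 * n) * c n l - q * (1 - q ^ n) * c (n - 1) (Suc l)" for l
  proof -
    have "(1 - a * q ^ n) * c (Suc n) (Suc l) - (1 - q ^ Suc n + q - a * q ^ n) * c n (Suc l)
       + q * (1 - q ^ n) * c (n - 1) (Suc l) = (-1) ^ Suc l * jcoeff a q (Suc l) *
       ((1 - a * q ^ n) * trunc_coeff q (Suc n) (Suc l)
       - (1 - q ^ Suc n + q - a * q ^ n) * trunc_coeff q n (Suc l)
       + q * (1 - q ^ n) * trunc_coeff q (n - 1) (Suc l))"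
      by (simp add: c_def algebra_simps)
    also have "\<dots> = (-1) ^ Suc l * trunc_coeff q n l * q ^ (2 * n) *
       (jcoeff a q (Suc l) * ((1 - q ^ Suc l) * (1 - a * q ^ l))) / q ^ (2 * l)"
      by (subst trunc_coeff_recurrence) simp_all
    also have "\<dots> = (-1) ^ Suc l * trunc_coeff q n l * q ^ (2 * n) * jcoeff a q l"
      unfolding jcoeff_Suc using q by simp
    also have "\<dots> = - (q ^ (2 * n) * c n l)" by (simp add: c_def)
    finally show ?thesis by simp
  qed
  have rec0: "(1 - a * q ^ n) * c (Suc n) 0 = (1 - q ^ Suc n + q - a * q ^ n) * c n 0
      - q * (1 - q ^ n) * c (n - 1) 0"
    by (simp add: c_def trunc_coeff_def algebra_simps)
  have cf: "coeff (q_laguerre a q N :: 'a poly) k = of_real (c N k)" for N k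
    by (simp only: coeff_q_laguerre c_def)
  have "smult (of_real (1 - a * q ^ n)) (q_laguerre a q (Suc n) :: 'a poly) =
     smult (of_real (1 - q ^ Suc n + q - a * q ^ n)) (q_laguerre a q n)
     - smult (of_real (q ^ (2 * n))) (pCons 0 (q_laguerre a q n))
     - smult (of_real (q * (1 - q ^ n))) (q_laguerre a q (n - 1))" (is "?L = ?R")
  proof (rule poly_eqI)
    fix k show "coeff ?L k = coeff ?R k"
    proof (cases k)
      case 0
      have "coeff ?L k = of_real ((1 - a * q ^ n) * c (Suc n) 0)"
        by (simp only: 0 coeff_smult cf of_real_mult)
      also have "\<dots> = coeff ?R k"
        unfolding rec0 by (simp add: 0 cf)
      finally show ?thesis .
    next
      case (Suc l)
      have "coeff ?L k = of_real ((1 - a * q ^ n) * c (Suc n) (Suc l))"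
        by (simp only: Suc coeff_smult cf of_real_mult)
      also have "\<dots> = coeff ?R k"
        unfolding rec by (simp add: Suc cf)
      finally show ?thesis .
    qed
  qed
  hence "poly ?L z = poly ?R z" by (rule arg_cong)
  thus ?thesis by (simp add: algebra_simps)
qed

lemma poly_q_laguerre:
  "poly (q_laguerre a q N) z = (\<Sum>k\<le>N. of_real ((-1) ^ k * (trunc_coeff q N k * jcoeff a q k)) * z ^ k)"
  by (simp add: q_laguerre_def poly_sum poly_monom)

text \<open>The three-term recurrence makes the quotients of consecutive polynomials map the upper
  half-plane to the lower one, so none of the polynomials vanishes there.\<close>

lemma Im_q_laguerre_quotient:
  fixes z :: complex
  assumes "0 < Im z"
  shows "Im (poly (q_laguerre a q (Suc n)) z * cnj (poly (q_laguerre a q n) z)) < 0"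
proof (induction n)
  case 0
  have "poly (q_laguerre a q (Suc 0)) z = 1 - of_real (trunc_coeff q 1 1 * jcoeff a q 1) * z"
    by (simp add: poly_q_laguerre)
  moreover have "poly (q_laguerre a q 0) z = 1"
    by (simp add: poly_q_laguerre jcoeff_def trunc_coeff_def qpoch_def)
  moreover have "0 < trunc_coeff q 1 1 * jcoeff a q 1"
    using trunc_coeff_pos_le(1)[of 1 1] jcoeff_pos[of 1] by simp
  ultimately show ?case using assms by (simp add: zero_less_mult_iff)
next
  case (Suc n)
  let ?P = "\<lambda>n. poly (q_laguerre a q n) z"
  have nz: "?P (Suc n) \<noteq> 0" using Suc by auto
  have r: "of_real (1 - a * q ^ Suc n) * ?P (Suc (Suc n)) =
     (of_real (1 - q ^ Suc (Suc n) + q - a * q ^ Suc n) - of_real (q ^ (2 * Suc n)) * z) * ?P (Suc n)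
     - of_real (q * (1 - q ^ Suc n)) * ?P n"
    using q_laguerre_recurrence[of "Suc n" z] by simp
  \<comment> \<open>After multiplication by the conjugate of \<open>?P (Suc n)\<close>, the real
    part of the middle coefficient drops out and two negative contributions remain.\<close>
  have "(1 - a * q ^ Suc n) * Im (?P (Suc (Suc n)) * cnj (?P (Suc n))) =
     Im (of_real (1 - a * q ^ Suc n) * ?P (Suc (Suc n)) * cnj (?P (Suc n)))"
    by (simp add: algebra_simps)
  also have "\<dots> = - (q ^ (2 * Suc n) * Im z * cmod (?P (Suc n)) ^ 2)
     + q * (1 - q ^ Suc n) * Im (?P (Suc n) * cnj (?P n))"
    unfolding r cmod_power2 by (simp add: algebra_simps power2_eq_square)
  also have "\<dots> < 0"
  proof -
    have "0 < q ^ (2 * Suc n) * Im z * cmod (?P (Suc n)) ^ 2"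
      using q assms nz by (intro mult_pos_pos) auto
    moreover have "q ^ Suc n < 1" using q by (intro power_Suc_less_one) auto
    hence "q * (1 - q ^ Suc n) * Im (?P (Suc n) * cnj (?P n)) < 0"
      using q Suc by (intro mult_pos_neg mult_pos_pos) auto
    ultimately show ?thesis by linarith
  qed
  finally show ?case
    using mult_power_less_one[of a "Suc n"] a by (simp add: mult_less_0_iff del: power_Suc)
qed

text \<open>Conjugation carries the absence of roots to the lower half-plane. On the nonpositive
  axis all terms are nonnegative and the constant term is 1.\<close>

lemma q_laguerre_positive_roots:
  assumes "poly (q_laguerre a q N) z = (0 :: complex)"
  shows "Im z = 0 \<and> 0 < Re z"
proof -
  have upper: "poly (q_laguerre a q N) w \<noteq> 0" if "0 < Im w" for w :: complex
    using Im_q_laguerre_quotient[OF that, of N] by auto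
  have "poly (q_laguerre a q N) (cnj z) = cnj (poly (q_laguerre a q N) z)"
    by (simp add: poly_q_laguerre)
  hence "Im z = 0" using upper[of z] upper[of "cnj z"] assms
    by (cases "Im z" "0 :: real" rule: linorder_cases) auto
  then obtain x where z: "z = of_real x" using complex_is_Real_iff by (auto elim: Reals_cases)
  have "0 < x"
  proof (rule ccontr)
    assume "\<not> 0 < x"
    have "poly (q_laguerre a q N) z = of_real (\<Sum>k\<le>N. (-1) ^ k * (trunc_coeff q N k * jcoeff a q k) * x ^ k)"
      by (simp add: poly_q_laguerre z)
    with assms have "(\<Sum>k\<le>N. (-1) ^ k * (trunc_coeff q N k * jcoeff a q k) * x ^ k) = 0"
      by (simp only: of_real_eq_0_iff)
    also have "(\<Sum>k\<le>N. (-1) ^ k * (trunc_coeff q N k * jcoeff a q k) * x ^ k) =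
      (\<Sum>k\<le>N. trunc_coeff q N k * jcoeff a q k * (- x) ^ k)"
      by (intro sum.cong refl) (subst power_minus, simp)
    finally have "(\<Sum>k\<le>N. trunc_coeff q N k * jcoeff a q k * (- x) ^ k) = 0" .
    moreover have "trunc_coeff q N 0 * jcoeff a q 0 * (- x) ^ 0 \<le> (\<Sum>k\<le>N. trunc_coeff q N k * jcoeff a q k * (- x) ^ k)"
      using \<open>\<not> 0 < x\<close> jcoeff_pos trunc_coeff_bounds
      by (intro member_le_sum mult_nonneg_nonneg zero_le_power) (auto simp: less_imp_le)
    ultimately show False using jcoeff_pos[of 0] by (simp add: trunc_coeff_def)
  qed
  thus ?thesis by (simp add: z)
qed

end

section \<open>Passage to the limit\<close>

text \<open>This and the next series are \<Phi> and \<open>H\<close>; the polymorphic type serves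
  both the complex disc and the real equation for the radius.\<close>

definition jackson_series :: "real \<Rightarrow> real \<Rightarrow> 'a \<Rightarrow> 'a::{real_normed_field,banach}" where
  "jackson_series a q z = (\<Sum>k. of_real ((-1) ^ k * jcoeff a q k) * z ^ k)"

definition star_series :: "real \<Rightarrow> real \<Rightarrow> 'a \<Rightarrow> 'a::{real_normed_field,banach}" where
  "star_series a q z = (\<Sum>k. of_real ((2 * real k + 1) * ((-1) ^ k * jcoeff a q k)) * z ^ k)"

text \<open>Power sums of the reciprocal roots of a function with coefficients \<open>(-1)\<^sup>k h\<^sub>k\<close>,
  by Newton's identities.\<close>

definition S1 :: "(nat \<Rightarrow> real) \<Rightarrow> real" where "S1 h = h 1"
definition S2 :: "(nat \<Rightarrow> real) \<Rightarrow> real" where "S2 h = h 1 ^ 2 - 2 * h 2"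
definition S3 :: "(nat \<Rightarrow> real) \<Rightarrow> real" where "S3 h = h 1 ^ 3 - 3 * h 1 * h 2 + 3 * h 3"
definition S4 :: "(nat \<Rightarrow> real) \<Rightarrow> real" where
  "S4 h = h 1 ^ 4 - 4 * h 1 ^ 2 * h 2 + 2 * h 2 ^ 2 + 4 * h 1 * h 3 - 4 * h 4"

definition star_coeff :: "real \<Rightarrow> real \<Rightarrow> nat \<Rightarrow> real" where
  "star_coeff a q k = (2 * real k + 1) * jcoeff a q k"

text \<open>Majorises the weight produced by differentiation by a geometric one, which merely
  rescales the variable.\<close>

lemma two_mult_plus_one_le: "2 * real k + 1 \<le> 2 * 2 ^ k"
proof -
  have "k + 1 \<le> 2 ^ k" by (induction k) auto
  hence "real (k + 1) \<le> real (2 ^ k)" by (simp only: of_nat_le_iff)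
  hence "real k + 1 \<le> 2 ^ k" by (simp add: add.commute)
  thus ?thesis by linarith
qed

section \<open>Convergence of the truncations to the entire functions\<close>

context
  fixes a q :: real
  assumes q: "0 < q" "q < 1" and a: "0 < a" "a < 1"
begin

text \<open>By \<open>jcoeff_Suc\<close> the ratio of consecutive terms is at most
  \<open>q ^ k * x / C\<close>, which tends to 0; \<open>C\<close> bounds all denominators from
  below.\<close>

lemma summable_jcoeff:
  assumes "0 \<le> x"
  shows "summable (\<lambda>k. jcoeff a q k * x ^ k)"
proof -
  define C where "C = (1 - q) * (1 - a)"
  have C: "0 < C" using q a by (simp add: C_def)
  have "(\<lambda>k. q ^ k * x / C) \<longlonglongrightarrow> 0 * x / C"
    using q C by (intro tendsto_intros LIMSEQ_realpow_zero) auto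
  hence "eventually (\<lambda>k. q ^ k * x / C < 1 / 2) sequentially"
    by (intro order_tendstoD(2)) auto
  then obtain N where N: "\<And>k. N \<le> k \<Longrightarrow> q ^ k * x / C < 1 / 2"
    by (auto simp: eventually_sequentially)
  show ?thesis
  proof (rule summable_ratio_test[of "1 / 2" N])
    fix k assume k: "N \<le> k"
    have J: "0 < jcoeff a q k" "0 < jcoeff a q (Suc k)"
      using jcoeff_pos[OF q a] by auto
    have qk: "q ^ k \<le> 1" "0 < q ^ k" using q by (auto intro: power_le_one)
    have c: "C \<le> (1 - q ^ Suc k) * (1 - a * q ^ k)"
    proof -
      have "q * q ^ k \<le> q * 1" "a * q ^ k \<le> a * 1" using q a qk by (auto intro: mult_left_mono)
      thus ?thesis unfolding C_def power_Suc using q a by (intro mult_mono) linarith+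
    qed
    have "jcoeff a q (Suc k) * C \<le> jcoeff a q (Suc k) * ((1 - q ^ Suc k) * (1 - a * q ^ k))"
      using c J by (intro mult_left_mono) auto
    also have "\<dots> = jcoeff a q k * q ^ (2 * k)" by (rule jcoeff_Suc[OF q a])
    also have "\<dots> \<le> jcoeff a q k * q ^ k"
      using J q by (intro mult_left_mono power_decreasing) auto
    finally have "jcoeff a q (Suc k) \<le> jcoeff a q k * q ^ k / C"
      using C by (simp add: field_simps)
    hence "jcoeff a q (Suc k) * x ^ Suc k \<le> jcoeff a q k * q ^ k / C * x ^ Suc k"
      using assms by (intro mult_right_mono) auto
    also have "\<dots> = (q ^ k * x / C) * (jcoeff a q k * x ^ k)" by simp
    also have "\<dots> \<le> 1 / 2 * (jcoeff a q k * x ^ k)"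
      using N[OF k] J assms by (intro mult_right_mono) auto
    finally show "norm (jcoeff a q (Suc k) * x ^ Suc k) \<le> 1 / 2 * norm (jcoeff a q k * x ^ k)"
      using J assms by (simp add: abs_mult)
  qed simp
qed

lemma summable_weighted_jcoeff:
  assumes "0 \<le> x"
  shows "summable (\<lambda>k. 2 * 2 ^ k * (jcoeff a q k * x ^ k))"
proof -
  have "summable (\<lambda>k. 2 * (jcoeff a q k * (2 * x) ^ k))"
    using assms by (intro summable_mult summable_jcoeff) auto
  also have "(\<lambda>k. 2 * (jcoeff a q k * (2 * x) ^ k)) = (\<lambda>k. 2 * 2 ^ k * (jcoeff a q k * x ^ k))"
    by (simp add: power_mult_distrib fun_eq_iff)
  finally show ?thesis .
qed

lemma summable_jackson:
  fixes z :: "'a::{real_normed_field,banach}"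
  shows "summable (\<lambda>k. of_real ((-1) ^ k * jcoeff a q k) * z ^ k)"
proof (rule summable_norm_cancel)
  have "norm (of_real ((-1) ^ k * jcoeff a q k) * z ^ k) = jcoeff a q k * norm z ^ k" for k
    using jcoeff_pos[OF q a, of k] by (simp add: norm_mult norm_power)
  thus "summable (\<lambda>k. norm (of_real ((-1) ^ k * jcoeff a q k) * z ^ k))"
    using summable_jcoeff[of "norm z"] by simp
qed

lemma DERIV_jackson_series:
  fixes z :: "'a::{real_normed_field,banach}"
  shows "\<exists>D. (jackson_series a q has_field_derivative D) (at z) \<and>
    jackson_series a q z + 2 * z * D = star_series a q z"
proof -
  let ?c = "\<lambda>k. of_real ((-1) ^ k * jcoeff a q k) :: 'a"
  let ?D = "\<Sum>n. diffs ?c n * z ^ n"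
  have D: "(jackson_series a q has_field_derivative ?D) (at z)"
    unfolding jackson_series_def[abs_def]
    by (rule termdiffs_strong_converges_everywhere) (rule summable_jackson)
  have "summable (\<lambda>n. diffs ?c n * z ^ n)"
    by (rule termdiff_converges_all) (rule summable_jackson)
  hence "(\<lambda>n. of_nat n * ?c n * z ^ (n - Suc 0)) sums ?D" by (rule diffs_equiv)
  hence "(\<lambda>n. 2 * z * (of_nat n * ?c n * z ^ (n - Suc 0))) sums (2 * z * ?D)" by (rule sums_mult)
  hence "(\<lambda>n. ?c n * z ^ n + 2 * z * (of_nat n * ?c n * z ^ (n - Suc 0))) sums
     (jackson_series a q z + 2 * z * ?D)"
    unfolding jackson_series_def by (intro sums_add summable_sums summable_jackson)
  also have "(\<lambda>n. ?c n * z ^ n + 2 * z * (of_nat n * ?c n * z ^ (n - Suc 0))) =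
     (\<lambda>n. of_real ((2 * real n + 1) * ((-1) ^ n * jcoeff a q n)) * z ^ n)"
  proof
    fix n show "?c n * z ^ n + 2 * z * (of_nat n * ?c n * z ^ (n - Suc 0)) =
      of_real ((2 * real n + 1) * ((-1) ^ n * jcoeff a q n)) * z ^ n"
      by (cases n) (simp_all add: algebra_simps)
  qed
  finally have "jackson_series a q z + 2 * z * ?D = star_series a q z"
    unfolding star_series_def by (rule sums_unique)
  with D show ?thesis by blast
qed

text \<open>Tannery's theorem with a majorant at a radius bounding all \<open>Z n\<close>. The
  weight covers both \<Phi> and \<open>H\<close>, and the moving argument allows evaluation at roots
  that vary with \<open>n\<close>.\<close>

lemma weighted_truncation_tendsto:
  fixes z :: "'a::{real_normed_field,banach}"
  assumes w: "\<And>k. 0 \<le> w k" "\<And>k. w k \<le> 2 * 2 ^ k"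
    and N: "filterlim N at_top sequentially" and Z: "Z \<longlonglongrightarrow> z"
  shows "(\<lambda>n. \<Sum>k\<le>N n. of_real (w k * ((-1) ^ k * (trunc_coeff q (N n) k * jcoeff a q k))) * Z n ^ k)
     \<longlonglongrightarrow> (\<Sum>k. of_real (w k * ((-1) ^ k * jcoeff a q k)) * z ^ k)"
proof -
  obtain R where R: "\<And>n. norm (Z n) \<le> R" "0 < R"
    using convergent_imp_Bseq[OF convergentI[OF Z]] unfolding Bseq_def by blast
  let ?t = "\<lambda>k n. of_real (w k * ((-1) ^ k * (trunc_coeff q (N n) k * jcoeff a q k))) * Z n ^ k"
  have "(\<lambda>n. suminf (\<lambda>k. ?t k n)) \<longlonglongrightarrow> (\<Sum>k. of_real (w k * ((-1) ^ k * jcoeff a q k)) * z ^ k)"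
  proof (rule tannerys_theorem[THEN conjunct2, THEN conjunct2])
    fix k
    have "(\<lambda>n. trunc_coeff q (N n) k) \<longlonglongrightarrow> 1"
      by (rule filterlim_compose[OF trunc_coeff_tendsto[OF q a] N])
    hence "?t k \<longlonglongrightarrow> of_real (w k * ((-1) ^ k * (1 * jcoeff a q k))) * z ^ k"
      by (intro tendsto_intros Z)
    thus "?t k \<longlonglongrightarrow> of_real (w k * ((-1) ^ k * jcoeff a q k)) * z ^ k" by simp
  next
    show "summable (\<lambda>k. 2 * 2 ^ k * (jcoeff a q k * R ^ k))"
      using R by (intro summable_weighted_jcoeff) auto
    have "norm (?t k n) \<le> 2 * 2 ^ k * (jcoeff a q k * R ^ k)" for k n
    proof -
      have "norm (?t k n) = w k * (trunc_coeff q (N n) k * jcoeff a q k * norm (Z n) ^ k)"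
        using w(1)[of k] trunc_coeff_bounds[OF q a, of "N n" k] jcoeff_pos[OF q a, of k]
        by (simp add: norm_mult norm_power abs_mult)
      also have "\<dots> \<le> 2 * 2 ^ k * (1 * jcoeff a q k * R ^ k)"
        using w[of k] trunc_coeff_bounds[OF q a, of "N n" k] jcoeff_pos[OF q a, of k] R
        by (intro mult_mono power_mono) (auto simp: less_imp_le)
      finally show ?thesis by simp
    qed
    thus "\<forall>\<^sub>F (k, n) in sequentially \<times>\<^sub>F sequentially. norm (?t k n) \<le> 2 * 2 ^ k * (jcoeff a q k * R ^ k)"
      by (intro always_eventually) auto
  qed simp
  \<comment> \<open>The coefficients of degree above \<open>N n\<close> vanish, so the series are
    finite sums.\<close>
  also have "(\<lambda>n. suminf (\<lambda>k. ?t k n)) = (\<lambda>n. \<Sum>k\<le>N n. ?t k n)"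
    by (intro ext suminf_finite) (auto simp: trunc_coeff_eq_0[OF q a])
  finally show ?thesis .
qed

lemma q_laguerre_tendsto:
  fixes z :: "'a::{real_normed_field,banach}"
  assumes "filterlim N at_top sequentially" "Z \<longlonglongrightarrow> z"
  shows "(\<lambda>n. poly (q_laguerre a q (N n)) (Z n)) \<longlonglongrightarrow> jackson_series a q z"
proof -
  have "(1::real) \<le> 2 * 2 ^ k" for k :: nat
    using one_le_power[of "2::real" k] by linarith
  from weighted_truncation_tendsto[of "\<lambda>_. 1", OF _ this assms] show ?thesis
    by (simp add: poly_q_laguerre[OF q a] jackson_series_def)
qed

lemma poly_star_q_laguerre:
  fixes z :: "'a::{real_normed_field,banach}"
  shows "poly (star_poly (q_laguerre a q N)) z =
    (\<Sum>k\<le>N. of_real ((2 * real k + 1) * ((-1) ^ k * (trunc_coeff q N k * jcoeff a q k))) * z ^ k)"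
proof -
  have "star_poly (q_laguerre a q N) =
    (\<Sum>k\<le>N. monom (of_real ((2 * real k + 1) * ((-1) ^ k * (trunc_coeff q N k * jcoeff a q k)))) k :: 'a poly)"
    by (rule poly_eqI)
      (simp add: coeff_star_poly coeff_q_laguerre[OF q a] coeff_sum trunc_coeff_eq_0[OF q a])
  thus ?thesis by (simp add: poly_sum poly_monom)
qed

lemma star_q_laguerre_tendsto:
  fixes z :: "'a::{real_normed_field,banach}"
  assumes "filterlim N at_top sequentially" "Z \<longlonglongrightarrow> z"
  shows "(\<lambda>n. poly (star_poly (q_laguerre a q (N n))) (Z n)) \<longlonglongrightarrow> star_series a q z"
proof -
  from weighted_truncation_tendsto[of "\<lambda>k. 2 * real k + 1", OF _ two_mult_plus_one_le assms] show ?thesis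
    by (simp add: poly_star_q_laguerre star_series_def)
qed

end

section \<open>Root bounds for the truncations and for their limit\<close>

context
  fixes a q :: real
  assumes q: "0 < q" "q < 1" and a: "0 < a" "a < 1"
begin

text \<open>The facts about the varying families of roots are restated through \<open>U\<close> and
  the first four coefficients, a form that passes to the limit.\<close>

lemma truncation_bounds:
  fixes N :: nat
  assumes N: "0 < N"
  defines "h \<equiv> \<lambda>k. trunc_coeff q N k * star_coeff a q k"
  shows "\<exists>U>0. U \<le> S1 h \<and> U ^ 2 \<le> S2 h \<and> U ^ 3 \<le> S3 h \<and> U ^ 4 \<le> S4 h
    \<and> 2 / 3 * U * (S1 h - U) \<le> U * S1 h - S2 h
    \<and> 2 / 3 * U * (S2 h - U ^ 2) \<le> U * S2 h - S3 h
    \<and> poly (star_poly (q_laguerre a q N)) (1 / complex_of_real U) = 0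
    \<and> (\<forall>z. cmod z * U \<le> 1 \<longrightarrow> 1 / 2 \<le> cmod (poly (q_laguerre a q N) z)
        \<and> 1 - cmod z * U \<le> Re (poly (star_poly (q_laguerre a q N)) z / poly (q_laguerre a q N) z))"
proof -
  let ?P = "q_laguerre a q N :: complex poly"
  have "poly ?P 0 = 1" by (simp add: poly_0_coeff_0 coeff_q_laguerre[OF q a] jcoeff_0[OF q a] trunc_coeff_0[OF q a])
  hence "\<exists>n v. (\<forall>i<(n::nat). 0 < v i) \<and> ?P = (\<Prod>i<n. [:1, - complex_of_real (v i):])"
    by (rule poly_positive_roots_factorization) (rule q_laguerre_positive_roots[OF q a])
  then obtain n :: nat and v where v: "\<forall>i<n. 0 < v i" "?P = (\<Prod>i<n. [:1, - complex_of_real (v i):])"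
    by blast
  \<comment> \<open>For \<open>N > 0\<close> the linear coefficient is nonzero, so the polynomial
    has a root.\<close>
  have "0 < trunc_coeff q N 1 * jcoeff a q 1"
    using N by (intro mult_pos_pos trunc_coeff_pos_le(1)[OF q a] jcoeff_pos[OF q a]) linarith
  hence "coeff ?P 1 \<noteq> 0"
    unfolding coeff_q_laguerre[OF q a] by auto
  moreover have "coeff ?P 1 = 0" if "n = 0"
    unfolding v(2) that by (simp add: coeff_1)
  ultimately have "n \<noteq> 0" by blast
  have "poly (star_poly ?P) 0 = 1"
    using \<open>poly ?P 0 = 1\<close> by (simp add: star_poly_def)
  moreover have "Im z = 0 \<and> 0 < Re z" if "poly (star_poly ?P) z = 0" for z
    using star_poly_positive_roots[of "{..<n}" v z] v that by simp
  ultimately have "\<exists>m u. (\<forall>j<(m::nat). 0 < u j) \<and> star_poly ?P = (\<Prod>j<m. [:1, - complex_of_real (u j):])"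
    by (rule poly_positive_roots_factorization)
  then obtain m :: nat and u where u: "\<forall>j<m. 0 < u j" "star_poly ?P = (\<Prod>j<m. [:1, - complex_of_real (u j):])"
    by blast
  interpret star_factorization "{..<n}" "{..<m}" v u
    using v u \<open>n \<noteq> 0\<close> by unfold_locales auto
  have P: "poly ?P z = (\<Prod>i<n. 1 - of_real (v i) * z)" for z
    by (simp add: v(2) poly_prod algebra_simps)
  have Q: "poly (star_poly ?P) z = (\<Prod>j<m. 1 - of_real (u j) * z)" for z
    by (simp add: u(2) poly_prod algebra_simps)
  define s where "s = (\<lambda>k. \<Sum>j<m. u j ^ k)"
  have c: "coeff (star_poly ?P) k = of_real ((-1) ^ k * h k)" for k
    by (simp add: coeff_star_poly coeff_q_laguerre[OF q a] h_def star_coeff_def)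
  note newton = newton_identities[of "{..<m}" "\<lambda>j. complex_of_real (u j)", OF finite_lessThan,
      folded u(2), unfolded c]
  have s1: "s 1 = S1 h"
  proof -
    have "complex_of_real (s 1) = of_real (S1 h)" using newton(2) by (simp add: s_def S1_def)
    thus ?thesis by (simp only: of_real_eq_iff)
  qed
  have s2: "s 2 = S2 h"
  proof -
    have "complex_of_real (s 2) = of_real (S2 h)" using newton(3) by (simp add: s_def S2_def)
    thus ?thesis by (simp only: of_real_eq_iff)
  qed
  have s3: "s 3 = S3 h"
  proof -
    have "complex_of_real (s 3) = of_real (S3 h)" using newton(4) by (simp add: s_def S3_def)
    thus ?thesis by (simp only: of_real_eq_iff)
  qed
  have s4: "s 4 = S4 h"
  proof -
    have "complex_of_real (s 4) = of_real (S4 h)" using newton(5) by (simp add: s_def S4_def)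
    thus ?thesis by (simp only: of_real_eq_iff)
  qed
  have le: "umax ^ k \<le> s k" for k unfolding s_def by (rule umax_power_le)
  have gap: "2 / 3 * umax * (s k - umax ^ k) \<le> umax * s k - s (Suc k)" for k
    unfolding s_def by (rule power_sum_gap)
  have e: "Suc 1 = 2" "Suc 2 = 3" by simp_all
  have g1: "2 / 3 * umax * (s 1 - umax) \<le> umax * s 1 - s 2"
    and g2: "2 / 3 * umax * (s 2 - umax ^ 2) \<le> umax * s 2 - s 3"
    using gap[of 1] gap[of 2] by (simp_all only: e power_one_right)
  have root: "poly (star_poly ?P) (1 / complex_of_real umax) = 0"
    unfolding Q using jmax umax_pos by (auto simp: umax_def)
  have le1: "umax \<le> s 1" using le[of 1] by simp
  show ?thesis
  proof (intro exI[of _ umax] conjI allI impI)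
    fix z assume z: "cmod z * umax \<le> 1"
    show "1 / 2 \<le> cmod (poly ?P z)" unfolding P using z by (rule starlike_bound)
    show "1 - cmod z * umax \<le> Re (poly (star_poly ?P) z / poly ?P z)"
      unfolding P Q using z by (rule starlike_bound)
  qed (use umax_pos le1 le[of 2] le[of 3] le[of 4] g1 g2 root in \<open>simp_all only: s1 s2 s3 s4\<close>)
qed

text \<open>The values \<open>U\<close> for the truncations lie in a compact interval. Along a
  convergent subsequence all non-strict inequalities, the root equation and the disc estimates
  survive.\<close>

lemma limit_bounds:
  defines "h \<equiv> star_coeff a q"
  assumes S2: "0 < S2 h"
  shows "\<exists>U>0. U \<le> S1 h \<and> U ^ 2 \<le> S2 h \<and> U ^ 3 \<le> S3 h \<and> U ^ 4 \<le> S4 h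
    \<and> 2 / 3 * U * (S1 h - U) \<le> U * S1 h - S2 h
    \<and> 2 / 3 * U * (S2 h - U ^ 2) \<le> U * S2 h - S3 h
    \<and> star_series a q (1 / complex_of_real U) = 0
    \<and> (\<forall>z. cmod z * U < 1 \<longrightarrow> jackson_series a q z \<noteq> 0
        \<and> 1 - cmod z * U \<le> Re (star_series a q z / jackson_series a q z))"
proof -
  define H where "H = (\<lambda>N k. trunc_coeff q N k * h k)"
  let ?P = "\<lambda>N. poly (q_laguerre a q N) :: complex \<Rightarrow> complex"
  let ?Q = "\<lambda>N. poly (star_poly (q_laguerre a q N)) :: complex \<Rightarrow> complex"
  define good where "good = (\<lambda>N U. 0 < U \<and> U \<le> S1 (H N) \<and> U ^ 2 \<le> S2 (H N) \<and> U ^ 3 \<le> S3 (H N) \<and> U ^ 4 \<le> S4 (H N)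
    \<and> 2 / 3 * U * (S1 (H N) - U) \<le> U * S1 (H N) - S2 (H N)
    \<and> 2 / 3 * U * (S2 (H N) - U ^ 2) \<le> U * S2 (H N) - S3 (H N)
    \<and> ?Q N (1 / complex_of_real U) = 0
    \<and> (\<forall>z. cmod z * U \<le> 1 \<longrightarrow> 1 / 2 \<le> cmod (?P N z)
        \<and> 1 - cmod z * U \<le> Re (?Q N z / ?P N z)))"
  have "\<exists>U. good (Suc N) U" for N
    unfolding good_def H_def h_def by (rule truncation_bounds) simp
  then obtain V where V: "\<And>N. good (Suc N) (V N)" by metis
  have "V N \<in> {0..h 1}" for N
  proof -
    have "0 < V N" "V N \<le> S1 (H (Suc N))" using V[of N] by (auto simp: good_def)
    moreover have "S1 (H (Suc N)) \<le> 1 * h 1"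
      unfolding S1_def H_def using trunc_coeff_bounds[OF q a, of "Suc N" 1] jcoeff_pos[OF q a, of 1]
      by (intro mult_right_mono) (auto simp: h_def star_coeff_def)
    ultimately show ?thesis by simp
  qed
  hence "\<forall>N. V N \<in> {0..h 1}" by blast
  from seq_compactE[OF compact_imp_seq_compact[OF compact_Icc] this]
  obtain U r where Ur: "U \<in> {0..h 1}" "strict_mono r" "(V \<circ> r) \<longlonglongrightarrow> U" by blast
  define N where "N = (\<lambda>n. Suc (r n))"
  define X where "X = V \<circ> r"
  have N: "filterlim N at_top sequentially"
    unfolding N_def using Ur(2) by (intro filterlim_compose[OF filterlim_Suc filterlim_subseq])
  have X: "X \<longlonglongrightarrow> U" using Ur by (simp add: X_def)
  have g: "good (N n) (X n)" for n using V[of "r n"] by (simp add: X_def N_def)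
  have gz: "\<forall>z. cmod z * X n \<le> 1 \<longrightarrow> 1 / 2 \<le> cmod (?P (N n) z)
        \<and> 1 - cmod z * X n \<le> Re (?Q (N n) z / ?P (N n) z)" for n
    using g[of n] unfolding good_def by (elim conjE) assumption
  have Hlim: "(\<lambda>n. H (N n) k) \<longlonglongrightarrow> h k" for k
    using tendsto_mult[OF filterlim_compose[OF trunc_coeff_tendsto[OF q a] N] tendsto_const, of k "h k"]
    by (simp add: H_def)
  have L1: "(\<lambda>n. S1 (H (N n))) \<longlonglongrightarrow> S1 h" and L2: "(\<lambda>n. S2 (H (N n))) \<longlonglongrightarrow> S2 h"
    and L3: "(\<lambda>n. S3 (H (N n))) \<longlonglongrightarrow> S3 h" and L4: "(\<lambda>n. S4 (H (N n))) \<longlonglongrightarrow> S4 h"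
    unfolding S1_def S2_def S3_def S4_def by (intro tendsto_intros Hlim)+
  have le: "x \<le> y" if "f \<longlonglongrightarrow> x" "f' \<longlonglongrightarrow> y" "\<And>n. f n \<le> f' n" for f f' :: "nat \<Rightarrow> real" and x y
    using that by (intro LIMSEQ_le) auto
  have b1: "U \<le> S1 h" by (rule le[OF X L1]) (use g in \<open>simp add: good_def\<close>)
  have b2: "U ^ 2 \<le> S2 h" by (rule le[OF tendsto_power[OF X] L2]) (use g in \<open>simp add: good_def\<close>)
  have b3: "U ^ 3 \<le> S3 h" by (rule le[OF tendsto_power[OF X] L3]) (use g in \<open>simp add: good_def\<close>)
  have b4: "U ^ 4 \<le> S4 h" by (rule le[OF tendsto_power[OF X] L4]) (use g in \<open>simp add: good_def\<close>)
  have g1: "2 / 3 * U * (S1 h - U) \<le> U * S1 h - S2 h"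
    by (rule le[of "\<lambda>n. 2 / 3 * X n * (S1 (H (N n)) - X n)" _ "\<lambda>n. X n * S1 (H (N n)) - S2 (H (N n))"])
      (intro tendsto_intros X L1 L2, intro tendsto_intros X L1 L2, use g in \<open>simp add: good_def\<close>)
  have g2: "2 / 3 * U * (S2 h - U ^ 2) \<le> U * S2 h - S3 h"
    by (rule le[of "\<lambda>n. 2 / 3 * X n * (S2 (H (N n)) - X n ^ 2)" _ "\<lambda>n. X n * S2 (H (N n)) - S3 (H (N n))"])
      (intro tendsto_intros X L3 L2, intro tendsto_intros X L3 L2, use g in \<open>simp add: good_def\<close>)
  \<comment> \<open>For \<open>U = 0\<close> the gap inequality would read
    \<open>0 \<le> - S2 h\<close>.\<close>
  have "U \<noteq> 0" using g1 S2 by auto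
  hence U: "0 < U" using Ur by auto
  have "(\<lambda>n. ?Q (N n) (1 / complex_of_real (X n))) \<longlonglongrightarrow> star_series a q (1 / complex_of_real U)"
    using U by (intro star_q_laguerre_tendsto[OF q a N] tendsto_intros X) auto
  moreover have "(\<lambda>n. ?Q (N n) (1 / complex_of_real (X n))) = (\<lambda>n. 0)"
    using g by (simp add: good_def)
  ultimately have root: "star_series a q (1 / complex_of_real U) = 0"
    using LIMSEQ_unique tendsto_const by metis
  have "jackson_series a q z \<noteq> 0 \<and> 1 - cmod z * U \<le> Re (star_series a q z / jackson_series a q z)"
    if z: "cmod z * U < 1" for z
  proof -
    have P: "(\<lambda>n. ?P (N n) z) \<longlonglongrightarrow> jackson_series a q z"
      by (rule q_laguerre_tendsto[OF q a N tendsto_const])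
    have Q: "(\<lambda>n. ?Q (N n) z) \<longlonglongrightarrow> star_series a q z"
      by (rule star_q_laguerre_tendsto[OF q a N tendsto_const])
    have "(\<lambda>n. cmod z * X n) \<longlonglongrightarrow> cmod z * U" by (intro tendsto_intros X)
    hence ev: "eventually (\<lambda>n. cmod z * X n < 1) sequentially" using z by (rule order_tendstoD(2))
    have "1 / 2 \<le> cmod (jackson_series a q z)"
    proof (rule tendsto_lowerbound[OF tendsto_norm[OF P]])
      show "eventually (\<lambda>n. 1 / 2 \<le> cmod (?P (N n) z)) sequentially"
        using ev by eventually_elim (use gz in \<open>simp add: less_imp_le\<close>)
    qed simp
    hence nz: "jackson_series a q z \<noteq> 0" by auto
    have "1 - cmod z * U \<le> Re (star_series a q z / jackson_series a q z)"
    proof (rule tendsto_le)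
      show "(\<lambda>n. Re (?Q (N n) z / ?P (N n) z)) \<longlonglongrightarrow> Re (star_series a q z / jackson_series a q z)"
        by (intro tendsto_intros P Q nz)
      show "(\<lambda>n. 1 - cmod z * X n) \<longlonglongrightarrow> 1 - cmod z * U" by (intro tendsto_intros X)
      show "eventually (\<lambda>n. 1 - cmod z * X n \<le> Re (?Q (N n) z / ?P (N n) z)) sequentially"
        using ev by eventually_elim (use gz in \<open>simp add: less_imp_le\<close>)
    qed simp
    with nz show ?thesis by blast
  qed
  with U b1 b2 b3 b4 g1 g2 root show ?thesis by (intro exI[of _ U] conjI allI impI) simp_all
qed

end

section \<open>Euler-Rayleigh inequalities\<close>

context
  fixes a q :: real
  assumes q: "0 < q" "q < 1" and a: "0 < a" "a < 1"
begin

section \<open>Explicit power sums\<close>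

lemma star_coeff_1_to_4:
  "star_coeff a q 1 = 3 / ((1 - q) * (1 - a))"
  "star_coeff a q 2 = 5 * q^2 / ((1 - q) * (1 - q^2) * ((1 - a) * (1 - a * q)))"
  "star_coeff a q 3 = 7 * q^6 / ((1 - q) * (1 - q^2) * (1 - q^3) * ((1 - a) * (1 - a * q) * (1 - a * q^2)))"
  "star_coeff a q 4 = 9 * q^12 / ((1 - q) * (1 - q^2) * (1 - q^3) * (1 - q^4)
      * ((1 - a) * (1 - a * q) * (1 - a * q^2) * (1 - a * q^3)))"
  by (simp_all add: star_coeff_def jcoeff_def qpoch_def numeral_eq_Suc)

lemma star_coeff_pos: "0 < star_coeff a q k"
  using jcoeff_pos[OF q a, of k] by (simp add: star_coeff_def)

lemma denom_pos: "0 < 1 - q ^ Suc k" "0 < 1 - a * q ^ k"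
  using mult_power_less_one[OF q a, of q k] mult_power_less_one[OF q a, of a k] q a by auto

lemma denoms_pos:
  "0 < 1 - q" "0 < 1 - q^2" "0 < 1 - q^3" "0 < 1 - q^4"
  "0 < 1 - a" "0 < 1 - a * q" "0 < 1 - a * q^2" "0 < 1 - a * q^3"
  using denom_pos(1)[of 0] denom_pos(1)[of 1] denom_pos(1)[of 2] denom_pos(1)[of 3]
    denom_pos(2)[of 0] denom_pos(2)[of 1] denom_pos(2)[of 2] denom_pos(2)[of 3]
  by (simp_all add: numeral_eq_Suc)

lemma S1_eq: "S1 (star_coeff a q) = 3 / ((1 - q) * (1 - a))"
  by (simp only: S1_def star_coeff_1_to_4)

text \<open>The numerator is \<open>D_nu\<close> with \<open>a\<close> in place of
  \<open>q powr (\<nu> + 1)\<close>.\<close>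

lemma S2_eq: "S2 (star_coeff a q) =
   (9*q - 9*(a*q) + a*q^2 - 10*q^2 + 9) / ((1 - q)^2 * (1 + q) * ((1 - a)^2 * (1 - a*q)))"
proof -
  have "1 - q^2 = (1 - q) * (1 + q)" by (simp add: power2_eq_square algebra_simps)
  moreover have "1 - q \<noteq> 0" "1 + q \<noteq> 0" "1 - a \<noteq> 0" "1 - a * q \<noteq> 0" using denoms_pos q by auto
  ultimately show ?thesis
    unfolding S2_def star_coeff_1_to_4
    by (simp add: divide_simps) (simp add: algebra_simps power2_eq_square)
qed

text \<open>The expression is affine in \<open>a\<close>, with positive values
  \<open>9 + 9 * q - 10 * q^2\<close> at 0 and \<open>9 * (1 - q^2)\<close> at 1.\<close>

lemma D_pos: "0 < 9*q - 9*(a*q) + a*q^2 - 10*q^2 + 9"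
proof -
  have "q^2 < 1" using denoms_pos(2) by simp
  hence "0 < (1 - a) * (9 + 9 * q - 10 * q^2) + 9 * a * (1 - q^2)"
    using q a power_strict_decreasing[of 1 2 q] by (intro add_pos_pos mult_pos_pos) auto
  thus ?thesis by (simp add: algebra_simps)
qed

lemma S2_pos: "0 < S2 (star_coeff a q)"
  unfolding S2_eq using D_pos denoms_pos q by (intro divide_pos_pos mult_pos_pos) auto

text \<open>The numerator is three times \<open>a_nu + b_nu\<close>.\<close>

lemma S3_eq: "S3 (star_coeff a q) =
   3 * ((-9*(a*q) - 12*(a*q^2) - 21*(a*q^3) + 3*(a*q^4) + 6*(a*q^5) + a*q^6 + 9*(a^2*q^3) + 3*(a^2*q^4))
     + (3*(a^2*q^5) + a^2*q^6 + 18*q + 3*q^2 - 6*q^3 - 15*q^4 + 7*q^6 + 9))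
   / ((1 - q)^3 * ((1 + q) * (1 + q + q^2)) * ((1 - a)^3 * (1 - a*q) * (1 - a*q^2)))"
proof -
  have "1 - q^2 = (1 - q) * (1 + q)" "1 - q^3 = (1 - q) * (1 + q + q^2)"
    by (simp_all add: power2_eq_square power3_eq_cube algebra_simps)
  moreover have "1 - q \<noteq> 0" "1 + q \<noteq> 0" "1 - a \<noteq> 0" "1 - a * q \<noteq> 0" "1 - a * q^2 \<noteq> 0" "1 + q + q^2 \<noteq> 0"
    using denoms_pos q by (auto simp: add_pos_pos intro!: less_imp_neq[symmetric])
  ultimately show ?thesis
    unfolding S3_def star_coeff_1_to_4
    by (simp add: divide_simps) (simp add: algebra_simps eval_nat_numeral)
qed

text \<open>The second elementary symmetric function of the squared reciprocal roots of \<open>H\<close>,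
  cleared of denominators.\<close>

lemma E2_numerator_pos:
  "0 < 25 * ((1 - q^3) * (1 - q^4) * ((1 - a*q^2) * (1 - a*q^3)))
     - 42 * q^2 * ((1 - q^2) * (1 - q^4) * ((1 - a*q) * (1 - a*q^3)))
     + 18 * q^8 * ((1 - q) * (1 - q^2) * ((1 - a) * (1 - a*q)))"
proof -
  \<comment> \<open>The numerator is quadratic in \<open>a\<close> and is split by its values at the
    ends: \<open>(1 - q)^3 * (1 + q) * b\<close> at \<open>a = 0\<close> and, up to positive
    factors, \<open>(1 - q) * c + 25 * q * (1 - q^3)\<close> at \<open>a = 1\<close>. Near
    \<open>q = 1\<close> the number \<open>c\<close> is negative, hence the help from
    \<open>25 * q\<close>.\<close>
  define b where "b = 25 + 50*q + 58*q^2 + 41*q^3 + 24*q^4 - 18*q^5 - 18*q^6 - 18*q^7"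
  define c where "c = 25 + 25*q - 17*q^2 - 42*q^3"
  have qk: "0 < q ^ k" for k using q by simp
  have "q^5 \<le> q^2" "q^6 \<le> q^3" "q^7 \<le> q^4" using q by (auto intro!: power_decreasing)
  hence b: "0 < b" unfolding b_def
    using qk[of 2] qk[of 3] qk[of 4] q by linarith
  have "q^2 \<le> q" "q^3 \<le> q" using q power_decreasing[of 1 2 q] power_decreasing[of 1 3 q] by auto
  hence c': "0 < c + 25 * q" unfolding c_def using q by linarith
  have "(1 - q) ^ 2 * (1 + q) * ((1 - a * q) * (1 - a) * ((1 - q) * b)
      + a * (1 + q^2) * ((1 - q) * (1 + q + q^2) * ((1 - a*q) * c + 25 * q * (1 - a*q^3)))) =
     25 * ((1 - q^3) * (1 - q^4) * ((1 - a*q^2) * (1 - a*q^3)))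
     - 42 * q^2 * ((1 - q^2) * (1 - q^4) * ((1 - a*q) * (1 - a*q^3)))
     + 18 * q^8 * ((1 - q) * (1 - q^2) * ((1 - a) * (1 - a*q)))"
    unfolding b_def c_def by algebra
  moreover have "a * q^3 \<le> a * q" using a q power_decreasing[of 1 3 q] by (intro mult_left_mono) auto
  hence "25 * q * (1 - a * q) \<le> 25 * q * (1 - a * q^3)" using q by (intro mult_left_mono) auto
  hence "(1 - a*q) * (c + 25 * q) \<le> (1 - a*q) * c + 25 * q * (1 - a*q^3)"
    by (simp add: algebra_simps)
  hence e: "0 < (1 - a*q) * c + 25 * q * (1 - a*q^3)"
    using mult_pos_pos[OF denoms_pos(6) c'] by linarith
  have "0 < (1 - q) ^ 2 * (1 + q) * ((1 - a * q) * (1 - a) * ((1 - q) * b)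
      + a * (1 + q^2) * ((1 - q) * (1 + q + q^2) * ((1 - a*q) * c + 25 * q * (1 - a*q^3))))"
  proof (intro mult_pos_pos[of "(1 - q) ^ 2 * (1 + q)"] add_pos_pos)
    show "0 < (1 - a * q) * (1 - a) * ((1 - q) * b)"
      using denoms_pos b by (intro mult_pos_pos) auto
    show "0 < a * (1 + q^2) * ((1 - q) * (1 + q + q^2) * ((1 - a*q) * c + 25 * q * (1 - a*q^3)))"
      by (intro mult_pos_pos e) (use q a in \<open>auto intro: add_pos_pos\<close>)
  qed (use q in auto)
  ultimately show ?thesis by simp
qed

text \<open>The difference \<open>S2^2 - S4\<close> is twice the second elementary symmetric
  function of the squares, \<open>h 2 ^ 2 - 2 * h 1 * h 3 + 2 * h 4\<close>. Over the common
  denominator \<open>d\<close> its numerator is \<open>q^4\<close> times that of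
  \<open>E2_numerator_pos\<close>.\<close>

lemma S4_less: "S4 (star_coeff a q) < S2 (star_coeff a q) ^ 2"
proof -
  let ?h = "star_coeff a q"
  define d where "d = (1 - q)^2 * (1 - q^2)^2 * (1 - a)^2 * (1 - a*q)^2 * (1 - q^3) * (1 - q^4) * (1 - a*q^2) * (1 - a*q^3)"
  have nz: "1 - q \<noteq> 0" "1 - q^2 \<noteq> 0" "1 - q^3 \<noteq> 0" "1 - q^4 \<noteq> 0"
    "1 - a \<noteq> 0" "1 - a * q \<noteq> 0" "1 - a * q^2 \<noteq> 0" "1 - a * q^3 \<noteq> 0" using denoms_pos by simp_all
  have h22: "?h 2 ^ 2 = q^4 * (25 * ((1 - q^3) * (1 - q^4) * ((1 - a*q^2) * (1 - a*q^3)))) / d"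
    unfolding star_coeff_1_to_4 d_def power_divide power_mult_distrib
    using nz by (simp add: divide_simps flip: power_mult)
  have h13: "2 * ?h 1 * ?h 3 = q^4 * (42 * q^2 * ((1 - q^2) * (1 - q^4) * ((1 - a*q) * (1 - a*q^3)))) / d"
    unfolding star_coeff_1_to_4 d_def using nz
    by (simp add: divide_simps) (simp add: power2_eq_square flip: power_add)
  have h4: "2 * ?h 4 = q^4 * (18 * q^8 * ((1 - q) * (1 - q^2) * ((1 - a) * (1 - a*q)))) / d"
    unfolding star_coeff_1_to_4 d_def using nz
    by (simp add: divide_simps) (simp add: power2_eq_square flip: power_add)
  have "?h 2 ^ 2 - 2 * ?h 1 * ?h 3 + 2 * ?h 4 =
     q^4 * (25 * ((1 - q^3) * (1 - q^4) * ((1 - a*q^2) * (1 - a*q^3)))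
     - 42 * q^2 * ((1 - q^2) * (1 - q^4) * ((1 - a*q) * (1 - a*q^3)))
     + 18 * q^8 * ((1 - q) * (1 - q^2) * ((1 - a) * (1 - a*q)))) / d"
    unfolding h22 h13 h4 by (simp add: ring_distribs add_divide_distrib diff_divide_distrib)
  also have "\<dots> > 0"
    using E2_numerator_pos q denoms_pos unfolding d_def by (intro divide_pos_pos mult_pos_pos) auto
  finally have "0 < ?h 2 ^ 2 - 2 * ?h 1 * ?h 3 + 2 * ?h 4" .
  moreover have "S2 ?h ^ 2 - S4 ?h = 2 * (?h 2 ^ 2 - 2 * ?h 1 * ?h 3 + 2 * ?h 4)"
    unfolding S2_def S4_def by algebra
  ultimately have "0 < S2 ?h ^ 2 - S4 ?h" by (simp only: zero_less_mult_iff) simp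
  thus ?thesis by simp
qed

text \<open>The power bounds of order 2 and 4 give strict bounds of order 1 and 2, since
  \<open>U^2 \<le> S2 < S1^2\<close> and \<open>U^4 \<le> S4 < S2^2\<close>. The gap inequalities
  then become strict upper bounds for \<open>x = 1 / U\<close>.\<close>

lemma euler_rayleigh_bounds:
  defines "h \<equiv> star_coeff a q"
  shows "\<exists>x>0. 1 / S1 h < x \<and> x < S1 h / S2 h \<and> 1 / S2 h < x^2 \<and> x < S2 h / S3 h
    \<and> 0 < S2 h \<and> 0 < S3 h \<and> star_series a q (complex_of_real x) = 0
    \<and> (\<forall>z. cmod z < x \<longrightarrow> jackson_series a q z \<noteq> 0
        \<and> 0 < Re (star_series a q z / jackson_series a q z))"
proof -
  have S2: "0 < S2 h" unfolding h_def by (rule S2_pos)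
  obtain U where U: "0 < U" "U \<le> S1 h" "U ^ 2 \<le> S2 h" "U ^ 3 \<le> S3 h" "U ^ 4 \<le> S4 h"
    "2 / 3 * U * (S1 h - U) \<le> U * S1 h - S2 h"
    "2 / 3 * U * (S2 h - U ^ 2) \<le> U * S2 h - S3 h"
    "star_series a q (1 / complex_of_real U) = 0"
    and z: "\<And>z. cmod z * U < 1 \<Longrightarrow> jackson_series a q z \<noteq> 0
        \<and> 1 - cmod z * U \<le> Re (star_series a q z / jackson_series a q z)"
    using limit_bounds[OF q a S2[unfolded h_def]] unfolding h_def by (elim exE conjE) blast
  have S3: "0 < S3 h" using less_le_trans[OF zero_less_power[OF U(1)] U(4)] .
  have "S2 h < S1 h ^ 2"
    unfolding S1_def S2_def using star_coeff_pos[of 2] by (simp add: h_def)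
  hence "U ^ 2 < S1 h ^ 2" using U by linarith
  hence U1: "U < S1 h" using U by (intro power_less_imp_less_base[of U 2]) auto
  have "U ^ 4 < S2 h ^ 2" using U(5) S4_less by (simp add: h_def)
  hence "(U ^ 2) ^ 2 < S2 h ^ 2" by (simp flip: power_mult)
  hence U2: "U ^ 2 < S2 h" using S2 by (intro power_less_imp_less_base[of "U^2" 2]) auto
  have "0 < 2 / 3 * U * (S1 h - U)" using U U1 by simp
  hence V1: "S2 h < U * S1 h" using U(6) by linarith
  have "0 < 2 / 3 * U * (S2 h - U ^ 2)" using U U2 by simp
  hence V2: "S3 h < U * S2 h" using U(7) by linarith
  show ?thesis
  proof (intro exI[of _ "1 / U"] conjI allI impI)
    show "1 / S1 h < 1 / U" using U U1 by (simp add: frac_less2)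
    show "1 / U < S1 h / S2 h" using U S2 V1 by (simp add: field_simps)
    show "1 / S2 h < (1 / U)^2" using U S2 U2 by (simp add: power_divide frac_less2)
    show "1 / U < S2 h / S3 h" using U S3 V2 by (simp add: field_simps)
    show "star_series a q (complex_of_real (1 / U)) = 0" using U by simp
    fix w assume "cmod w < 1 / U"
    hence w: "cmod w * U < 1" using U by (simp add: field_simps)
    show "jackson_series a q w \<noteq> 0" using z[OF w] by blast
    show "0 < Re (star_series a q w / jackson_series a q w)" using z[OF w] w by linarith
  qed (use U S2 S3 in auto)
qed

end

section \<open>The radius of starlikeness\<close>

context
  fixes a q :: real
  assumes q: "0 < q" "q < 1" and a: "0 < a" "a < 1"
begin

lemma summable_star:
  fixes z :: "'a::{real_normed_field,banach}"
  shows "summable (\<lambda>k. of_real ((2 * real k + 1) * ((-1) ^ k * jcoeff a q k)) * z ^ k)"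
proof (rule summable_comparison_test)
  show "summable (\<lambda>k. 2 * 2 ^ k * (jcoeff a q k * norm z ^ k))"
    by (rule summable_weighted_jcoeff[OF q a]) simp
  have "norm (of_real ((2 * real k + 1) * ((-1) ^ k * jcoeff a q k)) * z ^ k)
     \<le> 2 * 2 ^ k * (jcoeff a q k * norm z ^ k)" for k
  proof -
    have "norm (of_real ((2 * real k + 1) * ((-1) ^ k * jcoeff a q k)) * z ^ k) =
       (2 * real k + 1) * (jcoeff a q k * norm z ^ k)"
      using jcoeff_pos[OF q a, of k] by (simp only: norm_mult norm_power norm_of_real) (simp add: abs_mult)
    also have "\<dots> \<le> 2 * 2 ^ k * (jcoeff a q k * norm z ^ k)"
      using jcoeff_pos[OF q a, of k] by (intro mult_right_mono two_mult_plus_one_le) auto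
    finally show ?thesis .
  qed
  thus "\<exists>N. \<forall>k\<ge>N. norm (of_real ((2 * real k + 1) * ((-1) ^ k * jcoeff a q k)) * z ^ k)
     \<le> 2 * 2 ^ k * (jcoeff a q k * norm z ^ k)" by blast
qed

lemma star_series_of_real:
  "star_series a q (of_real x :: 'a::{real_normed_field,banach}) = of_real (star_series a q x)"
  unfolding star_series_def of_real_power[symmetric] of_real_mult[symmetric]
  by (subst suminf_of_real) (use summable_star[of x] in simp_all)

lemma qpoch_inf_nonzero:
  assumes "0 < c" "c < 1"
  shows "qpoch_inf c q \<noteq> 0"
proof -
  have "summable (\<lambda>k. \<bar>- (c * q ^ k)\<bar>)"
    using assms q summable_mult[OF summable_geometric[of q], of c] by (simp add: abs_mult)
  moreover have ne: "- (c * q ^ k) \<noteq> -1" for k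
    using mult_power_less_one[OF q a assms, of k] by simp
  ultimately have "convergent_prod (\<lambda>k. 1 + - (c * q ^ k))"
    by (rule summable_imp_convergent_prod_real)
  hence "prodinf (\<lambda>k. 1 + - (c * q ^ k)) \<noteq> 0"
    using ne by (intro prodinf_nonzero) (auto simp: add_eq_0_iff)
  thus ?thesis by (simp add: qpoch_inf_def)
qed

end

section \<open>Return from the variable w to z and r\<close>

context
  fixes q \<nu> a :: real
  assumes q: "0 < q" "q < 1" and nu: "-1 < \<nu>"
  defines "a \<equiv> q powr (\<nu> + 1)"
begin

lemma a_bounds: "0 < a" "a < 1"
  using q nu powr_less_mono'[of q 0 "\<nu> + 1"] by (auto simp: a_def)

lemma q_powr: "q powr (real n * (real n + \<nu>)) = q ^ (n * (n - 1)) * a ^ n"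
proof -
  have "real n * (real n + \<nu>) = real (n * (n - 1)) + (\<nu> + 1) * real n"
    by (cases n) (auto simp: algebra_simps)
  hence "q powr (real n * (real n + \<nu>)) = q powr real (n * (n - 1)) * q powr ((\<nu> + 1) * real n)"
    by (simp only: powr_add)
  also have "q powr real (n * (n - 1)) = q ^ (n * (n - 1))" using q by (rule_tac powr_realpow) simp
  also have "q powr ((\<nu> + 1) * real n) = a ^ n"
    unfolding a_def powr_powr[symmetric] using q by (intro powr_realpow) simp
  finally show ?thesis .
qed

lemma jackson_J2_real_eq:
  assumes "0 < r"
  shows "jackson_J2_real \<nu> q r =
    qpoch_inf a q / qpoch_inf q q * ((r / 2) powr \<nu> * jackson_series a q (a / 4 * r^2))"
proof -
  have "(-1) ^ n * (r / 2) powr (2 * real n + \<nu>) * q powr (real n * (real n + \<nu>)) / (qpoch q q n * qpoch a q n)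
     = (r / 2) powr \<nu> * (of_real ((-1) ^ n * jcoeff a q n) * (a / 4 * r^2) ^ n)" for n
  proof -
    have "(r / 2) powr (2 * real n + \<nu>) = (r / 2) powr real (2 * n) * (r / 2) powr \<nu>"
      by (simp add: powr_add)
    also have "(r / 2) powr real (2 * n) = (r / 2) ^ (2 * n)" using assms by (intro powr_realpow) simp
    also have "\<dots> = (r^2 / 4) ^ n" by (simp add: power_mult power_divide)
    finally show ?thesis
      unfolding q_powr by (simp add: jcoeff_def power_mult_distrib power_divide mult_ac)
  qed
  thus ?thesis
    unfolding jackson_J2_real_def jackson_series_def
    by (simp add: suminf_mult summable_jackson[OF q a_bounds, of "a / 4 * r^2", simplified]
        flip: a_def)
qed

text \<open>Differentiating \<open>(r / 2) powr \<nu>\<close> yields \<nu> times the Bessel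
  function, which leaves \<Phi> + 2 w \<Phi>' with a prefactor that has no zero for
  \<open>r > 0\<close>.\<close>

lemma star_equation:
  assumes r: "0 < r"
  shows "r * deriv (jackson_J2_real \<nu> q) r - (\<nu> - 1) * jackson_J2_real \<nu> q r =
    qpoch_inf a q / qpoch_inf q q * (r / 2) powr \<nu> * star_series a q (a / 4 * r^2)"
proof -
  define C where "C = qpoch_inf a q / qpoch_inf q q"
  obtain D where D: "(jackson_series a q has_field_derivative D) (at (a / 4 * r^2))"
    "jackson_series a q (a / 4 * r^2) + 2 * (a / 4 * r^2) * D = star_series a q (a / 4 * r^2)"
    using DERIV_jackson_series[OF q a_bounds] by blast
  have "((\<lambda>r. jackson_series a q (a / 4 * r^2)) has_field_derivative D * (a / 2 * r)) (at r)"
    by (rule DERIV_chain2[where g = "\<lambda>r. a / 4 * r^2", OF D(1)]) (auto intro!: derivative_eq_intros)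
  moreover have "((\<lambda>r. (r / 2) powr \<nu>) has_field_derivative \<nu> * (r / 2) powr \<nu> / r) (at r)"
    using r by (auto intro!: derivative_eq_intros simp: powr_diff)
  ultimately have "((\<lambda>r. C * ((r / 2) powr \<nu> * jackson_series a q (a / 4 * r^2))) has_field_derivative
      C * (\<nu> * (r / 2) powr \<nu> / r * jackson_series a q (a / 4 * r^2) + D * (a / 2 * r) * (r / 2) powr \<nu>)) (at r)"
    by (intro DERIV_cmult DERIV_mult)
  hence "(jackson_J2_real \<nu> q has_field_derivative
      C * (\<nu> * (r / 2) powr \<nu> / r * jackson_series a q (a / 4 * r^2) + D * (a / 2 * r) * (r / 2) powr \<nu>)) (at r)"
    by (rule has_field_derivative_transform_within_open[of _ _ _ "{0<..}"])
      (use r jackson_J2_real_eq in \<open>auto simp: C_def\<close>)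
  hence "deriv (jackson_J2_real \<nu> q) r =
      C * (\<nu> * (r / 2) powr \<nu> / r * jackson_series a q (a / 4 * r^2) + D * (a / 2 * r) * (r / 2) powr \<nu>)"
    by (rule DERIV_imp_deriv)
  hence "r * deriv (jackson_J2_real \<nu> q) r =
      C * (r / 2) powr \<nu> * (\<nu> * jackson_series a q (a / 4 * r^2) + 2 * (a / 4 * r^2) * D)"
    using r by (simp add: field_simps power2_eq_square)
  thus ?thesis
    unfolding jackson_J2_real_eq[OF r] C_def[symmetric] D(2)[symmetric]
    by (simp add: algebra_simps)
qed

text \<open>Halving shifts the principal logarithm by the real number \<open>ln 2\<close> only, so
  the powers combine to \<open>z\<close> on the branch cut as well. At \<open>z = 0\<close> both
  sides are 0.\<close>

lemma g_nu2_eq: "g_nu2 \<nu> q z = z * jackson_series a q (of_real (a / 4) * z^2)"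
proof (cases "z = 0")
  case True
  thus ?thesis by (simp add: g_nu2_def)
next
  case z: False
  have "complex_of_real ((-1) ^ n * q powr (real n * (real n + \<nu>)) / (qpoch q q n * qpoch a q n))
       * (z / 2) powr complex_of_real (2 * real n + \<nu>)
     = (z / 2) powr complex_of_real \<nu> * (of_real ((-1) ^ n * jcoeff a q n) * (of_real (a / 4) * z^2) ^ n)" for n
  proof -
    have "(z / 2) powr complex_of_real (2 * real n + \<nu>) = (z / 2) powr of_nat (2 * n) * (z / 2) powr complex_of_real \<nu>"
      by (simp add: powr_add)
    also have "(z / 2) powr of_nat (2 * n) = (z / 2) ^ (2 * n)" using z by (intro powr_nat') simp
    also have "\<dots> = (z^2 / 4) ^ n" by (simp add: power_mult power_divide)
    finally show ?thesis
      unfolding q_powr by (simp add: jcoeff_def power_mult_distrib power_divide mult_ac)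
  qed
  hence J: "jackson_J2 \<nu> q z = complex_of_real (qpoch_inf a q / qpoch_inf q q) *
     ((z / 2) powr complex_of_real \<nu> * jackson_series a q (of_real (a / 4) * z^2))"
    unfolding jackson_J2_def jackson_series_def
    by (simp only: a_def[symmetric] suminf_mult[OF summable_jackson[OF q a_bounds]])
  have L: "Ln (z / 2) = Ln z - of_real (ln 2)"
    using z Ln_divide_of_real[of 2 z] by (simp add: Ln_of_real)
  have "(z / 2) powr complex_of_real \<nu> = exp (of_real \<nu> * Ln z - of_real (\<nu> * ln 2))"
    using z by (simp add: powr_def L right_diff_distrib)
  also have "\<dots> = z powr complex_of_real \<nu> / of_real (2 powr \<nu>)"
    using z by (simp add: powr_def exp_diff flip: exp_of_real)
  finally have h: "(z / 2) powr complex_of_real \<nu> = z powr complex_of_real \<nu> / of_real (2 powr \<nu>)" .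
  have "z powr complex_of_real (1 - \<nu>) * z powr complex_of_real \<nu> = z"
    using z by (simp flip: powr_add)
  moreover have "qpoch_inf a q \<noteq> 0" "qpoch_inf q q \<noteq> 0"
    using qpoch_inf_nonzero[OF q a_bounds] q a_bounds by auto
  hence "c_nu \<nu> q * (qpoch_inf a q / qpoch_inf q q) = 1" by (simp add: c_nu_def a_def)
  hence "complex_of_real (c_nu \<nu> q) * complex_of_real (qpoch_inf a q / qpoch_inf q q) = 1"
    by (metis of_real_mult of_real_1)
  moreover have "g_nu2 \<nu> q z = (complex_of_real (c_nu \<nu> q) * complex_of_real (qpoch_inf a q / qpoch_inf q q))
    * (z powr complex_of_real (1 - \<nu>) * z powr complex_of_real \<nu>) * jackson_series a q (of_real (a / 4) * z^2)"
    unfolding g_nu2_def J h by simp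
  ultimately show ?thesis by simp
qed

lemma g_nu2_log_deriv:
  assumes "z \<noteq> 0"
  shows "z * deriv (g_nu2 \<nu> q) z / g_nu2 \<nu> q z =
    star_series a q (of_real (a / 4) * z^2) / jackson_series a q (of_real (a / 4) * z^2)"
proof -
  let ?w = "of_real (a / 4) * z^2"
  obtain D where D: "(jackson_series a q has_field_derivative D) (at ?w)"
    "jackson_series a q ?w + 2 * ?w * D = star_series a q ?w"
    using DERIV_jackson_series[OF q a_bounds] by blast
  have "((\<lambda>z. jackson_series a q (of_real (a / 4) * z^2)) has_field_derivative D * (of_real (a / 2) * z)) (at z)"
    by (rule DERIV_chain2[where g = "\<lambda>z. of_real (a / 4) * z^2", OF D(1)]) (auto intro!: derivative_eq_intros)
  from DERIV_mult[OF DERIV_ident this]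
  have "(g_nu2 \<nu> q has_field_derivative 1 * jackson_series a q ?w + D * (of_real (a / 2) * z) * z) (at z)"
    by (simp add: g_nu2_eq[abs_def])
  hence "deriv (g_nu2 \<nu> q) z = 1 * jackson_series a q ?w + D * (of_real (a / 2) * z) * z"
    by (rule DERIV_imp_deriv)
  also have "\<dots> = star_series a q ?w"
    unfolding D(2)[symmetric] by (simp add: power2_eq_square)
  finally show ?thesis using assms by (simp add: g_nu2_eq)
qed

text \<open>The set under the supremum is the half-open interval up to \<open>R\<close>, where
  \<open>a / 4 * R^2 = x\<close>: at \<open>z = R\<close> the numerator, hence the quotient, is 0,
  so no \<open>r > R\<close> qualifies, while \<open>r = R\<close> tests only
  \<open>norm z < R\<close>.\<close>

lemma radius_starlike_g_nu2:
  assumes x: "0 < x" and root: "star_series a q (complex_of_real x) = 0"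
    and pos: "\<And>z. cmod z < x \<Longrightarrow> 0 < Re (star_series a q z / jackson_series a q z)"
  shows "radius_starlike (g_nu2 \<nu> q) = 2 * sqrt (x / a)"
proof -
  define R where "R = 2 * sqrt (x / a)"
  have a: "0 < a" by (rule a_bounds)
  have R: "0 < R" "a / 4 * R^2 = x" using x a by (simp_all add: R_def power_mult_distrib)
  have w: "complex_of_real (a / 4) * (of_real R)^2 = of_real x"
    by (metis R(2) of_real_mult of_real_power)
  have "{r. r > 0 \<and> (\<forall>z. z \<noteq> 0 \<and> norm z < r \<longrightarrow> Re (z * deriv (g_nu2 \<nu> q) z / g_nu2 \<nu> q z) > 0)} = {0<..R}"
  proof (intro equalityI subsetI)
    fix r assume "r \<in> {r. r > 0 \<and> (\<forall>z. z \<noteq> 0 \<and> norm z < r \<longrightarrow> Re (z * deriv (g_nu2 \<nu> q) z / g_nu2 \<nu> q z) > 0)}"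
    hence r: "0 < r" "\<And>z. z \<noteq> 0 \<Longrightarrow> norm z < r \<Longrightarrow> Re (z * deriv (g_nu2 \<nu> q) z / g_nu2 \<nu> q z) > 0"
      by auto
    have "r \<le> R"
    proof (rule ccontr)
      assume "\<not> r \<le> R"
      hence "0 < Re (of_real R * deriv (g_nu2 \<nu> q) (of_real R) / g_nu2 \<nu> q (of_real R))"
        using r(2)[of "of_real R"] R(1) by simp
      moreover have nz: "complex_of_real R \<noteq> 0" using R(1) by simp
      ultimately show False unfolding g_nu2_log_deriv[OF nz] w root by simp
    qed
    with r show "r \<in> {0<..R}" by simp
  next
    fix r assume r: "r \<in> {0<..R}"
    have "0 < Re (z * deriv (g_nu2 \<nu> q) z / g_nu2 \<nu> q z)" if z: "z \<noteq> 0" "norm z < r" for z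
    proof -
      have "norm z ^ 2 < R ^ 2" using z r by (intro power_strict_mono) auto
      hence "a / 4 * norm z ^ 2 < a / 4 * R ^ 2" using a by (intro mult_strict_left_mono) auto
      hence "cmod (of_real (a / 4) * z^2) < x" unfolding R(2) using a by (simp add: norm_mult norm_power)
      from pos[OF this] show ?thesis by (simp only: g_nu2_log_deriv[OF z(1)])
    qed
    with r show "r \<in> {r. r > 0 \<and> (\<forall>z. z \<noteq> 0 \<and> norm z < r \<longrightarrow> Re (z * deriv (g_nu2 \<nu> q) z / g_nu2 \<nu> q z) > 0)}"
      by auto
  qed
  thus ?thesis unfolding radius_starlike_def using R(1) by (simp add: R_def)
qed

end

section \<open>Assembly of the four bounds\<close>

lemma sqrt_eq_root_4: "0 \<le> y \<Longrightarrow> sqrt y = root 4 (y^2)"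
  by (rule real_root_pos_unique[symmetric]) (simp_all add: power4_eq_xxxx power2_eq_square)

theorem theorem2:
  fixes q \<nu> :: real
  assumes "0 < q" "q < 1" "\<nu> > -1"
  defines "rs \<equiv> radius_starlike (g_nu2 \<nu> q)"
  defines "E \<equiv> (\<lambda>r. r * deriv (jackson_J2_real \<nu> q) r - (\<nu> - 1) * jackson_J2_real \<nu> q r)"
  shows "rs > 0 \<and> E rs = 0 \<and> (\<forall>r. 0 < r \<and> r < rs \<longrightarrow> E r \<noteq> 0)
     \<and> 2 * sqrt ((q powr (\<nu>+1) - 1) * (q - 1) / (3 * q powr (\<nu>+1))) < rs
     \<and> rs < 2 * sqrt (3 * (q powr (\<nu>+1) - 1) * (q powr (\<nu>+2) - 1) * (1 - q^2)
                       / (q powr (\<nu>+1) * D_nu \<nu> q))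
     \<and> 2 * root 4 ((q powr (\<nu>+1) - 1)^2 * (1 - q powr (\<nu>+2)) * (q - 1)^2 * (q + 1)
                       / (q powr (2*\<nu>+2) * D_nu \<nu> q)) < rs
     \<and> rs < 2/3 * sqrt (3 * (1 - q powr (\<nu>+1)) * (q powr (\<nu>+3) - 1) * (q - 1)
                       / ((q + 1) * q powr (\<nu>+1)) * q1_star \<nu> q)"
proof -
  define a where "a = q powr (\<nu> + 1)"
  note q = assms(1,2) and nu = assms(3)
  note a = a_bounds[OF q nu, folded a_def]
  let ?h = "star_coeff a q"
  define D where "D = 9*q - 9*(a*q) + a*q^2 - 10*q^2 + 9"
  define A where "A = (-9*(a*q) - 12*(a*q^2) - 21*(a*q^3) + 3*(a*q^4) + 6*(a*q^5) + a*q^6 + 9*(a^2*q^3) + 3*(a^2*q^4))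
     + (3*(a^2*q^5) + a^2*q^6 + 18*q + 3*q^2 - 6*q^3 - 15*q^4 + 7*q^6 + 9)"
  have pw: "q powr (\<nu> + 1 + real k) = a * q ^ k" "q powr (2 * (\<nu> + 1) + real k) = a^2 * q ^ k" for k
  proof -
    show "q powr (\<nu> + 1 + real k) = a * q ^ k"
      using q by (simp only: powr_add[of q "\<nu> + 1"] powr_realpow a_def)
    have "q powr (2 * (\<nu> + 1)) = a ^ 2"
      using q by (simp add: a_def powr_powr mult.commute flip: powr_realpow)
    thus "q powr (2 * (\<nu> + 1) + real k) = a^2 * q ^ k"
      using q by (simp only: powr_add[of q "2 * (\<nu> + 1)"] powr_realpow)
  qed
  have p: "q powr (\<nu>+1) = a" "q powr (\<nu>+2) = a * q" "q powr (\<nu>+3) = a * q^2" "q powr (\<nu>+4) = a * q^3"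
    "q powr (\<nu>+5) = a * q^4" "q powr (\<nu>+6) = a * q^5" "q powr (\<nu>+7) = a * q^6"
    "q powr (2*\<nu>+2) = a^2" "q powr (2*\<nu>+5) = a^2 * q^3" "q powr (2*\<nu>+6) = a^2 * q^4"
    "q powr (2*\<nu>+7) = a^2 * q^5" "q powr (2*\<nu>+8) = a^2 * q^6"
    using pw(1)[of 0] pw(1)[of 1] pw(1)[of 2] pw(1)[of 3] pw(1)[of 4] pw(1)[of 5] pw(1)[of 6]
      pw(2)[of 0] pw(2)[of 3] pw(2)[of 4] pw(2)[of 5] pw(2)[of 6]
    by (simp_all add: algebra_simps)
  have D: "D_nu \<nu> q = D" and A: "a_nu \<nu> q + b_nu \<nu> q = A"
    unfolding D_nu_def a_nu_def b_nu_def p D_def A_def by simp_all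
  obtain x where x: "0 < x" "1 / S1 ?h < x" "x < S1 ?h / S2 ?h" "1 / S2 ?h < x^2" "x < S2 ?h / S3 ?h"
      "0 < S2 ?h" "0 < S3 ?h" "star_series a q (complex_of_real x) = 0"
    and xz: "\<And>z. cmod z < x \<Longrightarrow> jackson_series a q z \<noteq> 0
        \<and> 0 < Re (star_series a q z / jackson_series a q z)"
    using euler_rayleigh_bounds[OF q a] by (elim exE conjE) blast
  have rs: "rs = 2 * sqrt (x / a)"
    unfolding rs_def a_def
    by (rule radius_starlike_g_nu2[OF q nu x(1)]) (use x(8) xz in \<open>auto simp: a_def\<close>)
  have rs2: "a / 4 * rs^2 = x" and rs0: "0 < rs" using x a by (simp_all add: rs power_mult_distrib)
  have E: "E r = qpoch_inf a q / qpoch_inf q q * (r / 2) powr \<nu> * star_series a q (a / 4 * r^2)" if "0 < r" for r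
    unfolding E_def a_def by (rule star_equation[OF q nu that])
  have C: "qpoch_inf a q \<noteq> 0" "qpoch_inf q q \<noteq> 0"
    using qpoch_inf_nonzero[OF q a a] qpoch_inf_nonzero[OF q a q] by auto
  have "star_series a q x = 0"
    using x(8) unfolding star_series_of_real[OF q a] by (simp only: of_real_eq_0_iff)
  hence Ers: "E rs = 0" using E[OF rs0] rs2 by simp
  \<comment> \<open>A smaller \<open>r\<close> corresponds to a point of the disc of radius
    \<open>x\<close>, where the positive real part of the quotient prevents \<open>H\<close> from
    vanishing.\<close>
  have Er: "E r \<noteq> 0" if r: "0 < r" "r < rs" for r
  proof -
    have "r^2 < rs^2" using r by (intro power_strict_mono) auto
    hence "a / 4 * r^2 < a / 4 * rs^2" using a by (intro mult_strict_left_mono) auto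
    hence "cmod (of_real (a / 4 * r^2)) < x" using rs2 a by (simp only: norm_of_real) simp
    from xz[OF this] have "star_series a q (complex_of_real (a / 4 * r^2)) \<noteq> 0" by auto
    hence "star_series a q (a / 4 * r^2) \<noteq> 0"
      unfolding star_series_of_real[OF q a] by (simp only: of_real_eq_0_iff not_False_eq_True)
    moreover have "(r / 2) powr \<nu> \<noteq> 0" using r(1) by simp
    ultimately show ?thesis unfolding E[OF r(1)] using C by (simp only: mult_eq_0_iff divide_eq_0_iff) simp
  qed
  note S = S1_eq[OF q a] S2_eq[OF q a, folded D_def] S3_eq[OF q a, folded A_def]
  have nz: "1 - q \<noteq> 0" "1 + q \<noteq> 0" "1 - a \<noteq> 0" "1 - a * q \<noteq> 0" "1 - a * q^2 \<noteq> 0" "a \<noteq> 0"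
    "1 + q + q^2 \<noteq> 0" "D \<noteq> 0"
    using denoms_pos[OF q a] q a D_pos[OF q a] by (auto simp: D_def add_pos_pos intro!: less_imp_neq[symmetric])
  have "A \<noteq> 0" using x(7) unfolding S by auto
  \<comment> \<open>As \<open>rs = 2 * sqrt (x / a)\<close>, each radicand is a bound for
    \<open>x\<close> divided by \<open>a\<close>, or for \<open>x^2\<close> divided by
    \<open>a^2\<close> under the fourth root.\<close>
  have B1: "(a - 1) * (q - 1) / (3 * a) = (1 / S1 ?h) / a"
    unfolding S using nz by (simp add: divide_simps) (simp add: algebra_simps)
  have B2: "3 * (a - 1) * (a * q - 1) * (1 - q^2) / (a * D) = (S1 ?h / S2 ?h) / a"
    unfolding S using nz by (simp add: divide_simps) (simp add: algebra_simps eval_nat_numeral)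
  have B3: "(a - 1)^2 * (1 - a * q) * (q - 1)^2 * (q + 1) / (a^2 * D) = (1 / S2 ?h) / a^2"
    unfolding S using nz by (simp add: divide_simps) (simp add: algebra_simps eval_nat_numeral)
  \<comment> \<open>The 9 offsets the outer factor 2/3, which stands in place of 2.\<close>
  have B4: "3 * (1 - a) * (a * q^2 - 1) * (q - 1) / ((q + 1) * a) * ((q^3 + 2*q^2 + 2*q + 1) * D / A)
     = 9 * ((S2 ?h / S3 ?h) / a)"
  proof -
    have "q^3 + 2*q^2 + 2*q + 1 = (1 + q) * (1 + q + q^2)" by (simp add: algebra_simps eval_nat_numeral)
    thus ?thesis
      unfolding S using nz \<open>A \<noteq> 0\<close> by (simp add: divide_simps) (simp add: algebra_simps eval_nat_numeral)
  qed
  have sqrt_scale: "2 * sqrt y < 2 * sqrt z \<longleftrightarrow> y < z" for y z :: real by simp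
  have "2 * sqrt ((a - 1) * (q - 1) / (3 * a)) < rs"
    unfolding B1 rs using divide_strict_right_mono[OF x(2) a(1)] by (simp only: sqrt_scale)
  moreover have "rs < 2 * sqrt (3 * (a - 1) * (a * q - 1) * (1 - q^2) / (a * D))"
    unfolding B2 rs using divide_strict_right_mono[OF x(3) a(1)] by (simp only: sqrt_scale)
  moreover have "2 * root 4 ((a - 1)^2 * (1 - a * q) * (q - 1)^2 * (q + 1) / (a^2 * D)) < rs"
  proof -
    have "root 4 (1 / S2 ?h / a^2) < root 4 ((x / a)^2)"
      unfolding power_divide using x(4) a(1)
      by (intro real_root_less_mono divide_strict_right_mono) auto
    also have "\<dots> = sqrt (x / a)" using x a by (intro sqrt_eq_root_4[symmetric]) simp
    finally show ?thesis unfolding B3 rs by simp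
  qed
  moreover have "rs < 2/3 * sqrt (3 * (1 - a) * (a * q^2 - 1) * (q - 1) / ((q + 1) * a) * q1_star \<nu> q)"
  proof -
    have "x / a < S2 ?h / S3 ?h / a" using x a by (intro divide_strict_right_mono) auto
    hence "sqrt (x / a) < sqrt (S2 ?h / S3 ?h / a)" by simp
    moreover have "sqrt (9 * ((S2 ?h / S3 ?h) / a)) = 3 * sqrt (S2 ?h / S3 ?h / a)"
      by (subst real_sqrt_mult) simp
    ultimately show ?thesis unfolding q1_star_def D A B4 rs by simp
  qed
  ultimately show ?thesis
    unfolding p D using rs0 Ers Er by blast
qed

end
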